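(* Let $\mathbf{A}=(a_1,\dots,a_r)$ be a tuple of positive integers with $\gcd(a_1,\dots,a_r)=1$, and suppose $$ \frac{1}{(1-x^{a_1})\cdots(1-x^{a_r})}=\frac{p(x)}{(1-x)^m(1-x^{n_1})^{r_1}\cdots(1-x^{n_k})^{r_k}}, $$ where $p(x)\in\mathbb{Q}[x]$, $m\ge0$, $n_1,\dots,n_k\ge2$ are pairwise relatively prime divisors of entries of $\mathbf{A}$, and $r_1,\dots,r_k\ge1$ are integers (the multiplicities of $n_1,\dots,n_k$). Then for all integers $t\ge0$ $$ d(t;\mathbf{A})=W_1(t;\mathbf{A})+\sum_{j=1}^kW_{n_j}(t;\mathbf{A}), $$ where $$ W_1(t;\mathbf{A})=\frac{1}{a_1\cdots a_r}\sum_{j=0}^{r-1}\ \sum_{j_1+\cdots+j_r=j}(-1)^j\binom{t+r-j-1}{t}\frac{\tilde\beta_{j_1}(a_1)\cdots\tilde\beta_{j_r}(a_r)}{j_1!\cdots j_r!}, $$ and, for each $j=1,\dots,k$, $W_{n_j}(t;\mathbf{A})$ is a quasi-polynomial of degree $r_j-1$, i.e. of the form $\alpha^{(j)}_{r_j-1}(t)t^{r_j-1}+\cdots+\alpha^{(j)}_0(t)$ with each $\alpha^{(j)}_i(t)$ periodic in $t$ with period $n_j$, given by $$ W_{n_j}(t;\mathbf{A})=P_j(\xi_j)\frac{t^{r_j-1}}{(r_j-1)!}+O(t^{r_j-2}), $$ where $\xi_j=e^{2\pi i/n_j}$ and $$ P_j(\xi_j)=\frac{1}{n_j^{r_j}}\sum_{\alpha=1}^{n_j-1}\frac{p(\xi_j^\alpha)\,\xi_j^{-\alpha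 t}}{(1-\xi_j^\alpha)^m(1-\xi_j^{\alpha n_1})^{r_1}\cdots\widehat{(1-\xi_j^{\alpha n_j})^{r_j}}\cdots(1-\xi_j^{\alpha n_k})^{r_k}}, $$ the hat meaning that the factor is omitted.
   Context: The denumerant $d(t;\mathbf{A})$ is the number of $(x_1,\dots,x_r)\in\mathbb{Z}_{\ge 0}^r$ with $\sum_j a_jx_j=t$; equivalently $\prod_{j=1}^r (1-x^{a_j})^{-1}=\sum_{t\ge 0}d(t;\mathbf{A})x^t$. The reciprocal degenerate Bernoulli numbers $\tilde\beta_k(n)$ are defined by the expansion about $x=1$: $\frac{n(1-x)}{1-x^n}=\sum_{k\ge0}(-1)^k\frac{\tilde\beta_k(n)}{k!}(1-x)^k$. Let $\Psi_n(x)=1+x+\cdots+x^{n-1}$ and $s=r_1+\cdots+r_k$. For $r(x),s(x),a(x)\in\mathbb{Q}[x]$ with $a$ non-constant and $\gcd(s,a)=1$, $\mathrm{eval}\left(\frac{r(x)}{s(x)};a(x)\right)$ is the remainder of $\alpha(x)r(x)$ on division by $a(x)$, where $\alpha(x) s(x)\equiv1\pmod{a(x)}$. $W_{n_j}(t;\mathbf{A})$, the wave (periodic part) associated with $n_j$, is the coefficient of $x^t$ in the power series of $g_j(x)/(1-x^{n_j})^{r_j}$, where $$ g_j(x)=(1-x)^{r_j}\,\mathrm{eval}\!\left(\frac{p(x)}{(1-x)^{m+s}}\prod_{i\ne j}\frac{1}{\Psi_{n_i}(x)^{r_i}};\ \Psi_{n_j}(x)^{r_j}\right). $$ $O(\cdot)$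 is as $t\to\infty$. *)

theory Defs
  imports Complex_Main
    "HOL-Library.Landau_Symbols"
    "HOL-Computational_Algebra.Computational_Algebra"
    "HOL-Number_Theory.Cong"
begin

definition denumerant :: "nat \<Rightarrow> nat list \<Rightarrow> nat" where
  "denumerant t A =
     card {xs :: nat list. length xs = length A \<and> (\<Sum>i<length A. A ! i * xs ! i) = t}"

text \<open>
  The reciprocal degenerate Bernoulli numbers are read off the expansion of
  \<open>n (1 - x) / (1 - x ^ n)\<close> about \<open>x = 1\<close>.  The formal variable \<^term>\<open>fps_X\<close> below stands
  for \<open>1 - x\<close>, so that \<open>x\<close> is \<^term>\<open>1 - fps_X\<close>.  Numerator and denominator both have
  subdegree 1 (for \<open>n > 0\<close>), and division of formal power series cancels the common factor.
\<close>

definition recip_bernoulli_fps :: "nat \<Rightarrow> rat fps" where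
  "recip_bernoulli_fps n = of_nat n * fps_X / (1 - (1 - fps_X) ^ n)"

definition recip_bernoulli :: "nat \<Rightarrow> nat \<Rightarrow> rat" where
  "recip_bernoulli k n = (- 1) ^ k * fact k * fps_nth (recip_bernoulli_fps n) k"

lemma recip_bernoulli_expansion:
  assumes "n > 0"
  shows "Abs_fps (\<lambda>k. (- 1) ^ k * (recip_bernoulli k n / fact k)) * (1 - (1 - fps_X) ^ n)
           = of_nat n * fps_X"
proof -
  define D :: "rat fps" where "D = 1 - (1 - fps_X) ^ n"
  have c1: "fps_nth ((1 - fps_X :: rat fps) ^ k) 0 = 1" for k
    by (simp add: fps_nth_power_0)
  have D: "D = fps_X * (\<Sum>i<n. (1 - fps_X) ^ i)"
    unfolding D_def by (simp add: one_diff_power_eq)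
  have S: "fps_nth (\<Sum>i<n. (1 - fps_X :: rat fps) ^ i) 0 = of_nat n"
    by (simp add: fps_sum_nth c1)
  have "(\<Sum>i<n. (1 - fps_X :: rat fps) ^ i) dvd 1"
    using S assms by (simp add: fps_is_unit_iff)
  then have "D dvd fps_X"
    using D mult_dvd_mono[of fps_X fps_X _ 1] by auto
  then have "of_nat n * fps_X / D * D = of_nat n * fps_X"
    by (simp add: dvd_mult)
  moreover have "Abs_fps (\<lambda>k. (- 1) ^ k * (recip_bernoulli k n / fact k)) = of_nat n * fps_X / D"
    by (simp add: fps_eq_iff recip_bernoulli_def recip_bernoulli_fps_def D_def
        flip: power_mult_distrib mult.assoc)
  ultimately show ?thesis by (simp add: D_def)
qed

definition Psi :: "nat \<Rightarrow> rat poly" where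
  "Psi n = (\<Sum>i<n. monom 1 i)"

text \<open>
  \<open>eval_mod r s a\<close> is the remainder of \<open>r / s\<close> modulo \<open>a\<close>.  It is meaningful for \<open>s\<close> coprime
  to \<open>a\<close>, in which case it does not depend on the choice of the inverse of \<open>s\<close>.
\<close>

definition eval_mod :: "rat poly \<Rightarrow> rat poly \<Rightarrow> rat poly \<Rightarrow> rat poly" where
  "eval_mod r s a = ((SOME u. [u * s = 1] (mod a)) * r) mod a"

text \<open>
  The moduli \<open>n\<^sub>1, \<dots>, n\<^sub>k\<close> and their multiplicities \<open>r\<^sub>1, \<dots>, r\<^sub>k\<close> are given by two lists
  \<open>ns\<close>, \<open>rs\<close> of the same length, indexed from 0.
\<close>

definition wave_numerator ::
    "rat poly \<Rightarrow> nat \<Rightarrow> nat list \<Rightarrow> nat list \<Rightarrow> nat \<Rightarrow> rat poly" where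
  "wave_numerator p m ns rs j =
     (1 - monom 1 1) ^ (rs ! j) *
     eval_mod p
       ((1 - monom 1 1) ^ (m + sum_list rs) *
          (\<Prod>i\<in>{..<length ns} - {j}. Psi (ns ! i) ^ (rs ! i)))
       (Psi (ns ! j) ^ (rs ! j))"

definition wave :: "rat poly \<Rightarrow> nat \<Rightarrow> nat list \<Rightarrow> nat list \<Rightarrow> nat \<Rightarrow> nat \<Rightarrow> rat" where
  "wave p m ns rs j t =
     fps_nth (fps_of_poly (wave_numerator p m ns rs j) / (1 - fps_X ^ (ns ! j)) ^ (rs ! j)) t"

definition unit_root :: "nat \<Rightarrow> complex" where
  "unit_root n = exp (2 * of_real pi * \<i> / of_nat n)"

definition wave_lead :: "rat poly \<Rightarrow> nat \<Rightarrow> nat list \<Rightarrow> nat list \<Rightarrow> nat \<Rightarrow> nat \<Rightarrow> complex" where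
  "wave_lead p m ns rs j t =
     (let n = ns ! j; \<xi> = unit_root n in
        1 / of_nat n ^ (rs ! j) *
        (\<Sum>\<alpha> = 1..n - 1.
           poly (map_poly of_rat p) (\<xi> ^ \<alpha>) * \<xi> powi (- int (\<alpha> * t)) /
           ((1 - \<xi> ^ \<alpha>) ^ m *
            (\<Prod>i\<in>{..<length ns} - {j}. (1 - \<xi> ^ (\<alpha> * ns ! i)) ^ (rs ! i)))))"

end

theory Submission
  imports Defs "HOL-Computational_Algebra.Field_as_Ring"
begin

text \<open>
  The generating function of the denumerant is $F = \prod_i (1 - x^{a_i})^{-1}$.  Splitting
  $1 - x^{n_j}$ into $1 - x$ and $\Psi_{n_j}$, the given factorization makes it $p / (M \prod_j Q_j)$
  with $M = (1 - x)^{m+s}$, $s = \sum_j r_j$ and $Q_j = \Psi_{n_j}^{r_j}$.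
  As the $n_j$ are pairwise coprime, so are the $\Psi_{n_j}$, and none of them vanishes at 1; moreover $\deg p < \deg (M \prod_j Q_j)$ because
  $F$ has negative degree.  Hence there is a partial fraction decomposition
  \[ F = h / M + \sum_j e_j / Q_j, \qquad \deg h < m + s, \quad \deg e_j < \deg Q_j, \]
  and the numerator $e_j$, being determined modulo $Q_j$, is the remainder that defines the wave of
  $n_j$ (\<open>partial_fraction_decomposition\<close>, \<open>eval_mod_cong\<close>).  Since
  $1 - x^{n_j} = (1 - x) \Psi_{n_j}$, the power series of $e_j / Q_j$ is the one whose coefficients
  are the wave (\<open>wave_eq_fraction_coeff\<close>).
  
  The term $h / M$ is the polar part of $F$ at $x = 1$.  Multiplying
  $a_i (1 - x) / (1 - x^{a_i}) = \sum_k (-1)^k \tilde\beta_k(a_i) (1 - x)^k / k!$ over $i$ gives the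
  expansion of $(1 - x)^r F$ in powers of $1 - x$, so the polar part can also be read off from its
  first $r$ terms.  The two descriptions agree since a proper rational function whose only possible
  pole is 1 is zero once it is regular there (\<open>polar_part_at_1\<close>); taking coefficients of
  $(1 - x)^{-(r - j)}$ yields $W_1$.
  
  For the shape of a wave, write $e_j / Q_j = g / (1 - x^n)^{\rho}$ with $n = n_j$, $\rho = r_j$ and
  $\deg g < n \rho$.  Only the coefficients $g_k$ with $k \equiv t \pmod n$ contribute to the
  coefficient of $x^t$, each with a weight that is a polynomial in $t$ of degree $\rho - 1$ with top
  coefficient $1 / (n^{\rho - 1} (\rho - 1)!)$ (\<open>coeff_proper_fraction\<close>).  So the wave is a
  quasi-polynomial whose top coefficient is a multiple of $\sum_{k \equiv t} g_k$, and averaging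
  $g(z) z^{-t}$ over the $n$-th roots of unity evaluates that sum
  (\<open>sum_coeffs_in_residue_class\<close>).  At $z = 1$ the value of $g$ is 0; at any other root $z$ the
  polynomial $Q_j$ vanishes, so the congruence for $e_j$ becomes an equation for $e_j(z)$ and gives
  $g(z)$ in terms of $p(z)$ (\<open>wave_numerator_at_root\<close>).
\<close>

section \<open>The generating function of the denumerant\<close>

lemma finite_solutions:
  assumes "\<forall>a\<in>set A. a > (0::nat)"
  shows "finite {xs :: nat list. length xs = length A \<and> (\<Sum>i<length A. A ! i * xs ! i) = t}"
proof (rule finite_subset)
  show "{xs :: nat list. length xs = length A \<and> (\<Sum>i<length A. A ! i * xs ! i) = t}
          \<subseteq> {xs. set xs \<subseteq> {..t} \<and> length xs = length A}"
  proof safe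
    fix xs :: "nat list" and x
    assume len: "length xs = length A" and x: "x \<in> set xs" and t: "t = (\<Sum>i<length A. A ! i * xs ! i)"
    obtain i where i: "i < length A" "x = xs ! i"
      using x len by (metis in_set_conv_nth)
    have "1 * x \<le> A ! i * xs ! i"
      using i assms by (intro mult_le_mono) (auto simp: Suc_le_eq)
    also have "\<dots> \<le> (\<Sum>i<length A. A ! i * xs ! i)"
      using i(1) by (intro member_le_sum) auto
    finally show "x \<le> (\<Sum>i<length A. A ! i * xs ! i)" by simp
  qed
  show "finite {xs. set xs \<subseteq> {..t} \<and> length xs = length A}"
    by (rule finite_lists_length_eq) simp
qed

lemma denumerant_Nil: "denumerant t [] = (if t = 0 then 1 else 0)"
  by (auto simp: denumerant_def)

text \<open>
  The solutions whose first entry is zero are those of the shorter equation; lowering a positive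
  first entry by one gives the solutions with $t - a$ in place of $t$.
\<close>

lemma denumerant_Cons:
  assumes "a > 0" and "\<forall>b\<in>set A. b > 0"
  shows "denumerant t (a # A) =
           denumerant t A + (if a \<le> t then denumerant (t - a) (a # A) else 0)"
proof -
  define S where "S t = {xs :: nat list. length xs = length (a # A) \<and>
      (\<Sum>i<length (a # A). (a # A) ! i * xs ! i) = t}" for t
  define S0 where "S0 = {xs :: nat list. length xs = length A \<and> (\<Sum>i<length A. A ! i * xs ! i) = t}"
  have S_alt: "xs \<in> S u \<longleftrightarrow> (\<exists>y ys. xs = y # ys \<and> length ys = length A \<and>
      a * y + (\<Sum>i<length A. A ! i * ys ! i) = u)" for xs u
    by (cases xs) (auto simp: S_def sum.lessThan_Suc_shift simp del: sum.lessThan_Suc)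
  have fin: "finite (S u)" for u
    unfolding S_def using assms by (intro finite_solutions) auto
  have fin0: "finite S0"
    unfolding S0_def using assms by (intro finite_solutions) auto
  define inc where "inc xs = Suc (hd xs) # tl xs" for xs :: "nat list"
  have split: "S t = (\<lambda>ys. 0 # ys) ` S0 \<union> (if a \<le> t then inc ` S (t - a) else {})"
  proof (intro equalityI subsetI)
    fix xs assume "xs \<in> S t"
    then obtain y ys where ys: "xs = y # ys" "length ys = length A"
        "a * y + (\<Sum>i<length A. A ! i * ys ! i) = t"
      by (auto simp: S_alt)
    show "xs \<in> (\<lambda>ys. 0 # ys) ` S0 \<union> (if a \<le> t then inc ` S (t - a) else {})"
    proof (cases y)
      case 0
      then show ?thesis using ys by (auto simp: S0_def)
    next
      case (Suc z)
      have "a \<le> t" "z # ys \<in> S (t - a)"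
        using ys Suc by (auto simp: S_alt)
      moreover have "xs = inc (z # ys)" using ys Suc by (simp add: inc_def)
      ultimately show ?thesis by auto
    qed
  qed (auto simp: S_alt S0_def inc_def split: if_splits)
  have inj: "inj_on inc (S u)" for u
  proof (rule inj_onI)
    fix xs ys assume "xs \<in> S u" "ys \<in> S u" "inc xs = inc ys"
    then show "xs = ys" by (cases xs; cases ys) (auto simp: inc_def S_def)
  qed
  have "card (S t) = card ((\<lambda>ys. 0 # ys) ` S0) + card (if a \<le> t then inc ` S (t - a) else {})"
    unfolding split by (rule card_Un_disjoint) (auto simp: fin fin0 inc_def)
  also have "\<dots> = card S0 + (if a \<le> t then card (S (t - a)) else 0)"
    by (auto simp: card_image inj)
  finally show ?thesis
    unfolding S_def S0_def denumerant_def .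
qed

text \<open>
  Coefficientwise the recursion says that multiplication by $1 - x^a$ removes the entry $a$.
\<close>

lemma denumerant_generating_function:
  assumes "\<forall>a\<in>set A. a > 0"
  shows "Abs_fps (\<lambda>t. of_nat (denumerant t A)) * (\<Prod>i<length A. 1 - fps_X ^ (A ! i)) = (1 :: rat fps)"
  using assms
proof (induction A)
  case Nil
  then show ?case by (auto simp: denumerant_Nil fps_eq_iff)
next
  case (Cons a A)
  have "Abs_fps (\<lambda>t. of_nat (denumerant t (a # A))) * (1 - fps_X ^ a)
      = (Abs_fps (\<lambda>t. of_nat (denumerant t A)) :: rat fps)"
    using Cons.prems
    by (auto simp: fps_eq_iff right_diff_distrib fps_X_power_mult_right_nth denumerant_Cons)
  then show ?case
    using Cons by (simp add: prod.lessThan_Suc_shift mult.assoc[symmetric] del: prod.lessThan_Suc)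
qed

section \<open>The polynomials $1 - x^n$ and their quotients by $1 - x$\<close>

lemma one_minus_monom_eq_Psi: "1 - monom 1 n = (1 - monom 1 1) * Psi n"
proof -
  have "(monom 1 1 :: rat poly) ^ i = monom 1 i" for i
    by (simp add: monom_power)
  then show ?thesis
    using one_diff_power_eq[of "monom 1 1 :: rat poly" n] by (simp add: Psi_def)
qed

lemma poly_Psi_1: "poly (Psi n) 1 = of_nat n"
  by (simp add: Psi_def poly_sum poly_monom)

lemma degree_one_minus_monom: "degree (1 - monom 1 n :: rat poly) = n"
proof (cases "n = 0")
  case True
  then show ?thesis by (simp add: monom_0 flip: one_pCons)
next
  case False
  then have "degree (- monom 1 n + 1 :: rat poly) = degree (- monom 1 n :: rat poly)"
    by (intro degree_add_eq_left) (simp add: degree_monom_eq)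
  then show ?thesis by (simp add: degree_monom_eq)
qed

lemma one_minus_monom_nonzero: "n > 0 \<Longrightarrow> 1 - monom 1 n \<noteq> (0 :: rat poly)"
  using degree_one_minus_monom[of n] by auto

lemma Psi_nonzero: "n > 0 \<Longrightarrow> Psi n \<noteq> 0"
  using poly_Psi_1[of n] by auto

lemma degree_Psi: "n > 0 \<Longrightarrow> degree (Psi n) = n - 1"
  using degree_mult_eq[OF one_minus_monom_nonzero[of 1] Psi_nonzero[of n]] degree_one_minus_monom[of n] degree_one_minus_monom[of 1]
  by (simp add: one_minus_monom_eq_Psi[of n, symmetric] del: One_nat_def)

text \<open>
  A common divisor of $1 - x$ and $f$ divides the nonzero constant $f(1)$.
\<close>

lemma coprime_one_minus_x:
  assumes "poly f 1 \<noteq> 0"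
  shows "coprime (1 - monom 1 1) (f :: rat poly)"
proof (rule coprimeI)
  fix d assume d: "d dvd 1 - monom 1 1" "d dvd f"
  have "(1 - monom 1 1) dvd (f - [:poly f 1:])"
  proof -
    have "[:-1, 1:] dvd (f - [:poly f 1:])"
      by (simp add: poly_eq_0_iff_dvd[symmetric])
    moreover have "(1 - monom 1 1 :: rat poly) = - [:-1, 1:]"
      by (simp add: monom_altdef one_pCons)
    ultimately show ?thesis by (metis minus_dvd_iff)
  qed
  with d have "d dvd f - (f - [:poly f 1:])"
    by (meson dvd_diff dvd_trans)
  then have "d dvd [:poly f 1:]" by simp
  moreover have "is_unit [:poly f 1:]" using assms by (simp add: is_unit_pCons_iff)
  ultimately show "is_unit d" using dvd_trans by blast
qed

text \<open>
  With $a u = b v + 1$, a common divisor of $\Psi_a$ and $\Psi_b$ divides both $1 - x^{bv+1}$ and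
  $1 - x^{bv}$, hence their combination $1 - x$, which is coprime to $\Psi_a$.
\<close>

lemma coprime_Psi:
  assumes "coprime a b" and "a > 0"
  shows "coprime (Psi a) (Psi b)"
proof (rule coprimeI)
  fix d assume d: "d dvd Psi a" "d dvd Psi b"
  have q_dvd: "d dvd 1 - monom 1 (c * k)" if "d dvd Psi c" for c k
  proof -
    have "1 - monom 1 c dvd 1 - (monom 1 c :: rat poly) ^ k"
      by (simp add: one_diff_power_eq)
    then have "Psi c dvd 1 - monom 1 (c * k)"
      unfolding one_minus_monom_eq_Psi[of c] by (metis dvd_mult_right monom_power mult.commute power_one)
    with that show ?thesis by (rule dvd_trans)
  qed
  obtain u v where uv: "a * u = b * v + 1"
    using bezout_nat[of a b] assms by auto
  have "d dvd (1 - monom 1 (a * u)) - (1 - monom 1 (b * v)) + (1 - monom 1 1) * (1 - monom 1 (b * v))"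
    by (rule dvd_add[OF dvd_diff[OF q_dvd[OF d(1)] q_dvd[OF d(2)]] dvd_mult[OF q_dvd[OF d(2)]]])
  also have "\<dots> = 1 - monom 1 1"
    unfolding uv by (simp add: algebra_simps mult_monom)
  finally have "d dvd 1 - monom 1 1" .
  moreover have "coprime (1 - monom 1 1) (Psi a)"
    using assms by (intro coprime_one_minus_x) (simp add: poly_Psi_1)
  ultimately show "is_unit d"
    using d coprime_common_divisor by blast
qed

section \<open>Partial fractions over the rationals\<close>

text \<open>
  Bezout coefficients provide an inverse of $s$ modulo $a$, so the choice in the definition of the
  remainder picks a genuine one.
\<close>

lemma eval_mod_cong:
  assumes "coprime s a"
  shows "[eval_mod r s a * s = r] (mod a)"
proof -
  have "\<exists>u. [u * s = 1] (mod a)"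
  proof
    have "fst (bezout_coefficients s a) * s - 1 = - snd (bezout_coefficients s a) * a"
      using bezout_coefficients_fst_snd[of s a] assms by (simp add: algebra_simps)
    then show "[fst (bezout_coefficients s a) * s = 1] (mod a)"
      by (simp add: cong_iff_dvd_diff)
  qed
  then have "[(SOME u. [u * s = 1] (mod a)) * s = 1] (mod a)"
    by (rule someI_ex)
  then have "[(SOME u. [u * s = 1] (mod a)) * s * r = 1 * r] (mod a)"
    by (rule cong_scalar_right)
  moreover have "[eval_mod r s a * s = (SOME u. [u * s = 1] (mod a)) * r * s] (mod a)"
    unfolding eval_mod_def by (intro cong_scalar_right) simp
  ultimately show ?thesis
    by (metis (no_types, lifting) cong_trans mult.assoc mult.commute mult_1)
qed

lemma eval_mod_degree:
  assumes "a \<noteq> 0"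
  shows "eval_mod r s a = 0 \<or> degree (eval_mod r s a) < degree a"
  unfolding eval_mod_def using degree_mod_less[OF assms] by blast

lemma pairwise_coprime_prod_dvd:
  fixes Q :: "'i \<Rightarrow> rat poly"
  assumes "finite I"
    and "\<And>i j. i \<in> I \<Longrightarrow> j \<in> I \<Longrightarrow> i \<noteq> j \<Longrightarrow> coprime (Q i) (Q j)"
    and "\<And>i. i \<in> I \<Longrightarrow> Q i dvd c"
  shows "prod Q I dvd c"
  using assms
proof (induction I rule: finite_induct)
  case (insert x F)
  have "coprime (Q x) (prod Q F)"
    using insert by (intro prod_coprime_right) auto
  then show ?case
    using insert by (simp add: divides_mult)
qed simp

text \<open>
  Only the numerators over the $Q_i$ are prescribed, each by the congruence it has to satisfy.
  Subtracting their contribution from $p$ leaves a multiple of every $Q_i$, hence of the product, and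
  the cofactor is the numerator over $M$.  Its degree bound is inherited from the other terms, which
  are all proper.
\<close>

lemma partial_fraction_decomposition:
  fixes Q e :: "'i \<Rightarrow> rat poly" and M p :: "rat poly"
  assumes fin: "finite I"
    and cop: "\<And>i j. i \<in> I \<Longrightarrow> j \<in> I \<Longrightarrow> i \<noteq> j \<Longrightarrow> coprime (Q i) (Q j)"
    and cong: "\<And>i. i \<in> I \<Longrightarrow> [e i * (M * prod Q (I - {i})) = p] (mod Q i)"
    and deg: "\<And>i. i \<in> I \<Longrightarrow> e i = 0 \<or> degree (e i) < degree (Q i)"
    and nz: "M \<noteq> 0" "\<And>i. i \<in> I \<Longrightarrow> Q i \<noteq> 0"
    and proper: "degree p < degree (M * prod Q I)"
  obtains h where "p = (\<Sum>i\<in>I. e i * (M * prod Q (I - {i}))) + h * prod Q I"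
    and "h = 0 \<or> degree h < degree M"
proof -
  define s where "s = (\<Sum>i\<in>I. e i * (M * prod Q (I - {i})))"
  have "prod Q I dvd p - s"
  proof (rule pairwise_coprime_prod_dvd[OF fin cop])
    fix i assume i: "i \<in> I"
    define s' where "s' = (\<Sum>k\<in>I - {i}. e k * (M * prod Q (I - {k})))"
    have "Q i dvd s'"
      unfolding s'_def
    proof (rule dvd_sum)
      fix k assume "k \<in> I - {i}"
      then have "Q i dvd prod Q (I - {k})"
        using i fin by (intro dvd_prodI) auto
      then show "Q i dvd e k * (M * prod Q (I - {k}))" by simp
    qed
    moreover have "Q i dvd e i * (M * prod Q (I - {i})) - p"
      using cong[OF i] by (simp add: cong_iff_dvd_diff)
    ultimately have "Q i dvd - ((e i * (M * prod Q (I - {i})) - p) + s')"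
      by (simp only: dvd_minus_iff dvd_add)
    also have "- ((e i * (M * prod Q (I - {i})) - p) + s') = p - s"
      unfolding s_def s'_def sum.remove[OF fin i] by simp
    finally show "Q i dvd p - s" .
  qed
  then obtain h where h: "p - s = prod Q I * h" by blast
  have Unz: "prod Q I \<noteq> 0" using nz fin by simp
  have pos: "0 < degree (M * prod Q I)" using proper by linarith
  have "degree s < degree (M * prod Q I)"
    unfolding s_def
  proof (rule degree_sum_less)
    fix i assume i: "i \<in> I"
    have split: "prod Q I = Q i * prod Q (I - {i})"
      by (rule prod.remove[OF fin i])
    show "degree (e i * (M * prod Q (I - {i}))) < degree (M * prod Q I)"
    proof (cases "e i = 0")
      case False
      have "prod Q (I - {i}) \<noteq> 0" using nz fin by simp
      then show ?thesis
        using deg[OF i] False nz(1) nz(2)[OF i] unfolding split by (simp add: degree_mult_eq)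
    qed (use pos in simp)
  qed (fact pos)
  with proper have d: "degree (p - s) < degree (M * prod Q I)"
    by (rule degree_diff_less)
  show thesis
  proof
    show "p = (\<Sum>i\<in>I. e i * (M * prod Q (I - {i}))) + h * prod Q I"
      using h unfolding s_def[symmetric] by (simp add: algebra_simps)
    show "h = 0 \<or> degree h < degree M"
    proof (cases "h = 0")
      case False
      then show ?thesis using d Unz nz(1) unfolding h by (simp add: degree_mult_eq)
    qed simp
  qed
qed

section \<open>The polar part at 1\<close>

text \<open>
  The Taylor expansion at 1, in which the formal variable stands for $1 - x$.
\<close>

definition taylor1 :: "rat poly \<Rightarrow> rat fps" where
  "taylor1 f = fps_of_poly (pcompose f [:1, -1:])"

lemma taylor1_mult: "taylor1 (f * g) = taylor1 f * taylor1 g"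
  by (simp add: taylor1_def pcompose_mult fps_of_poly_mult)

lemma taylor1_add: "taylor1 (f + g) = taylor1 f + taylor1 g"
  by (simp add: taylor1_def pcompose_add fps_of_poly_add)

lemma taylor1_one: "taylor1 1 = 1"
  by (simp add: taylor1_def pcompose_1)

lemma taylor1_power: "taylor1 (f ^ n) = taylor1 f ^ n"
  by (induction n) (simp_all add: taylor1_one taylor1_mult)

lemma taylor1_prod: "taylor1 (prod f I) = (\<Prod>i\<in>I. taylor1 (f i))"
  by (simp add: taylor1_def pcompose_prod fps_of_poly_prod)

lemma taylor1_one_minus_monom: "taylor1 (1 - monom 1 n) = 1 - (1 - fps_X) ^ n"
proof -
  have "pcompose (monom 1 1) [:1, -1:] = ([:1, -1:] :: rat poly)"
    by (simp add: monom_altdef pcompose_pCons)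
  moreover have "fps_of_poly [:1, -1:] = (1 - fps_X :: rat fps)"
    by (simp add: fps_of_poly_pCons)
  ultimately have "taylor1 (monom 1 1) = 1 - fps_X"
    by (simp add: taylor1_def)
  then have "taylor1 (monom 1 1 ^ n) = (1 - fps_X) ^ n"
    by (simp add: taylor1_power)
  moreover have "taylor1 (1 - f) = 1 - taylor1 f" for f
    by (simp add: taylor1_def pcompose_diff fps_of_poly_diff pcompose_1)
  ultimately show ?thesis by (simp add: monom_power)
qed

lemma taylor1_nth_0: "taylor1 f $ 0 = poly f 1"
  by (simp add: taylor1_def pcompose_coeff_0)

lemma taylor1_nth_eq_0: "h = 0 \<or> degree h < N \<Longrightarrow> N \<le> k \<Longrightarrow> taylor1 h $ k = 0"
  by (cases "h = 0") (auto simp: taylor1_def degree_pcompose intro: coeff_eq_0)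

lemma taylor1_inj: "taylor1 f = taylor1 g \<Longrightarrow> f = g"
proof -
  assume "taylor1 f = taylor1 g"
  then have "pcompose (f - g) [:1, -1:] = 0"
    by (simp add: taylor1_def fps_of_poly_eq_iff pcompose_diff)
  then have "f - g = 0" by (rule pcompose_eq_0) simp
  then show ?thesis by simp
qed

text \<open>
  Comparing the principal part of a rational function $p / ((1-x)^N U)$ with the first $r$ terms of
  the Taylor series $C$ of its product with $(1 - x)^r$.  Both $h (1-x)^r$ and
  $(1-x)^N \sum_{j<r} C_j (1-x)^j$ are polynomials of degree less than $N + r$, and in powers of
  $1 - x$ they agree up to terms of order $N + r$; so they are equal.
\<close>

lemma polar_part_at_1:
  fixes C :: "rat fps"
  assumes p: "p = R * (1 - monom 1 1) ^ N + h * U"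
    and U: "poly U 1 \<noteq> 0"
    and h: "h = 0 \<or> degree h < N"
    and loc: "taylor1 p * fps_X ^ r = fps_X ^ N * taylor1 U * C"
  shows "fps_of_poly h * inverse ((1 - fps_X) ^ N) =
           (\<Sum>j<r. fps_const (C $ j) * inverse ((1 - fps_X) ^ (r - j)))"
proof -
  \<comment> \<open>The numerator over \<open>(1 - x) ^ r\<close> of the truncated expansion.\<close>
  define w where "w = (\<Sum>j<r. smult (C $ j) ((1 - monom 1 1) ^ j))"
  have t_q: "taylor1 ((1 - monom 1 1) ^ k) = fps_X ^ k" for k
    using taylor1_one_minus_monom[of 1] by (simp add: taylor1_power)
  have t_w: "taylor1 w = fps_cutoff r C"
  proof -
    have "taylor1 w = (\<Sum>j<r. fps_const (C $ j) * taylor1 ((1 - monom 1 1) ^ j))"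
      by (simp add: w_def taylor1_def pcompose_sum pcompose_smult fps_of_poly_sum fps_of_poly_smult)
    also have "\<dots> = fps_cutoff r C"
      unfolding t_q by (rule fps_ext) (simp add: fps_sum_nth if_distrib cong: if_cong)
    finally show ?thesis .
  qed
  have C_split: "C = fps_cutoff r C + fps_X ^ r * fps_shift r C"
    by (rule fps_ext) (simp add: fps_X_power_mult_nth)
  define V where "V = inverse (taylor1 U)"
  have V: "V * taylor1 U = 1"
    unfolding V_def using U by (intro inverse_mult_eq_1) (simp add: taylor1_nth_0)
  have "taylor1 p = taylor1 R * fps_X ^ N + taylor1 h * taylor1 U"
    unfolding p by (simp add: taylor1_add taylor1_mult t_q del: One_nat_def)
  then have "taylor1 h * taylor1 U * fps_X ^ r = fps_X ^ N * taylor1 U * C - taylor1 R * fps_X ^ (N + r)"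
    using loc by (simp add: algebra_simps power_add)
  then have "V * (taylor1 h * taylor1 U * fps_X ^ r) =
      V * (fps_X ^ N * taylor1 U * C - taylor1 R * fps_X ^ (N + r))"
    by simp
  then have "(V * taylor1 U) * taylor1 h * fps_X ^ r =
      fps_X ^ N * (V * taylor1 U) * C - V * taylor1 R * fps_X ^ (N + r)"
    by (simp only: right_diff_distrib mult_ac)
  then have "taylor1 h * fps_X ^ r = fps_X ^ N * C - V * taylor1 R * fps_X ^ (N + r)"
    unfolding V by simp
  also have "\<dots> = taylor1 w * fps_X ^ N + (fps_shift r C - V * taylor1 R) * fps_X ^ (N + r)"
    by (subst C_split) (simp add: t_w algebra_simps power_add)
  finally have hw: "taylor1 h * fps_X ^ r =
      taylor1 w * fps_X ^ N + (fps_shift r C - V * taylor1 R) * fps_X ^ (N + r)" .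
  \<comment> \<open>Below order \<open>N + r\<close> the error term is invisible; from there on both sides vanish by degree.\<close>
  have "taylor1 h * fps_X ^ r = taylor1 w * fps_X ^ N"
  proof (rule fps_ext)
    fix k
    show "(taylor1 h * fps_X ^ r) $ k = (taylor1 w * fps_X ^ N) $ k"
    proof (cases "k < N + r")
      case True
      then show ?thesis unfolding hw by (simp add: fps_X_power_mult_right_nth)
    next
      case False
      then show ?thesis
        using taylor1_nth_eq_0[OF h, of "k - r"] by (simp add: fps_X_power_mult_right_nth t_w)
    qed
  qed
  then have "taylor1 (h * (1 - monom 1 1) ^ r) = taylor1 (w * (1 - monom 1 1) ^ N)"
    by (simp add: taylor1_mult t_q del: One_nat_def)
  then have eq: "h * (1 - monom 1 1) ^ r = w * (1 - monom 1 1) ^ N"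
    by (rule taylor1_inj)
  define Y where "Y = (1 - fps_X :: rat fps)"
  define u where "u = inverse Y"
  have Yu: "Y ^ k * u ^ k = 1" for k
  proof -
    have "Y * u = 1" unfolding u_def Y_def by (rule inverse_mult_eq_1') simp
    then show ?thesis by (simp flip: power_mult_distrib)
  qed
  have inv: "inverse ((1 - fps_X :: rat fps) ^ k) = u ^ k" for k
    by (simp add: u_def Y_def fps_inverse_power)
  have fq: "fps_of_poly ((1 - monom 1 1 :: rat poly) ^ k) = Y ^ k" for k
    by (simp add: fps_of_poly_power fps_of_poly_diff fps_of_poly_monom Y_def)
  have fw: "fps_of_poly w = (\<Sum>j<r. fps_const (C $ j) * Y ^ j)"
    by (simp add: w_def fps_of_poly_sum fps_of_poly_smult fq del: One_nat_def)
  have "fps_of_poly h * u ^ N = fps_of_poly h * (Y ^ r * u ^ r) * u ^ N"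
    unfolding Yu by simp
  also have "\<dots> = fps_of_poly h * Y ^ r * (u ^ r * u ^ N)"
    by (simp only: mult.assoc)
  also have "fps_of_poly h * Y ^ r = fps_of_poly w * Y ^ N"
    using arg_cong[OF eq, of fps_of_poly] by (simp only: fps_of_poly_mult fq)
  also have "fps_of_poly w * Y ^ N * (u ^ r * u ^ N) = fps_of_poly w * u ^ r * (Y ^ N * u ^ N)"
    by (simp only: mult_ac)
  also have "\<dots> = fps_of_poly w * u ^ r"
    unfolding Yu by simp
  also have "\<dots> = (\<Sum>j<r. fps_const (C $ j) * u ^ (r - j))"
    unfolding fw sum_distrib_right
  proof (rule sum.cong[OF refl])
    fix j assume "j \<in> {..<r}"
    then have u: "u ^ r = u ^ j * u ^ (r - j)" by (simp flip: power_add)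
    have "fps_const (C $ j) * Y ^ j * u ^ r = fps_const (C $ j) * (Y ^ j * u ^ j) * u ^ (r - j)"
      unfolding u by (simp only: mult.assoc)
    then show "fps_const (C $ j) * Y ^ j * u ^ r = fps_const (C $ j) * u ^ (r - j)"
      unfolding Yu by simp
  qed
  finally show ?thesis unfolding inv .
qed

lemma fps_prod_lessThan_nth:
  fixes f :: "nat \<Rightarrow> 'a :: comm_ring_1 fps"
  assumes "0 < k"
  shows "(\<Prod>i<k. f i) $ n = (\<Sum>js | length js = k \<and> sum_list js = n. \<Prod>i<k. f i $ (js ! i))"
proof -
  obtain l where k: "k = Suc l" using assms gr0_implies_Suc by blast
  have "{..<k} = {0..l}" using k by auto
  then show ?thesis
    using fps_prod_nth[of f l n] k by (simp add: natpermute_def)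
qed

text \<open>
  The expansion of $(1 - x)^r \prod_i (1 - x^{a_i})^{-1}$ in powers of $1 - x$, where $r$ is the
  length of the list.
\<close>

definition expansion_at_1 :: "nat list \<Rightarrow> rat fps" where
  "expansion_at_1 A = fps_const (1 / (\<Prod>i<length A. of_nat (A ! i))) *
                  (\<Prod>i<length A. recip_bernoulli_fps (A ! i))"

lemma recip_bernoulli_fps_mult:
  assumes "n > 0"
  shows "recip_bernoulli_fps n * (1 - (1 - fps_X) ^ n) = of_nat n * fps_X"
proof -
  have "Abs_fps (\<lambda>k. (- 1) ^ k * (recip_bernoulli k n / fact k)) = recip_bernoulli_fps n"
    by (rule fps_ext) (simp add: recip_bernoulli_def flip: power_mult_distrib mult.assoc)
  then show ?thesis using recip_bernoulli_expansion[OF assms] by simp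
qed

lemma expansion_at_1_mult:
  assumes "\<forall>a\<in>set A. a > 0"
  shows "expansion_at_1 A * (\<Prod>i<length A. 1 - (1 - fps_X) ^ (A ! i)) = fps_X ^ length A"
proof -
  have nz: "(\<Prod>i<length A. rat_of_nat (A ! i)) \<noteq> 0" using assms by auto
  have "(\<Prod>i<length A. recip_bernoulli_fps (A ! i)) * (\<Prod>i<length A. 1 - (1 - fps_X) ^ (A ! i))
      = (\<Prod>i<length A. fps_const (of_nat (A ! i)) * fps_X)"
    using assms unfolding prod.distrib[symmetric]
    by (intro prod.cong) (auto simp: recip_bernoulli_fps_mult fps_of_nat)
  also have "\<dots> = fps_const (\<Prod>i<length A. of_nat (A ! i)) * fps_X ^ length A"
  proof -
    have "(\<Prod>i\<in>I. fps_const (f i)) = fps_const (prod f I)" for f :: "nat \<Rightarrow> rat" and I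
      by (induction I rule: infinite_finite_induct) simp_all
    then show ?thesis by (simp add: prod.distrib)
  qed
  finally have "expansion_at_1 A * (\<Prod>i<length A. 1 - (1 - fps_X) ^ (A ! i)) =
      fps_const (1 / (\<Prod>i<length A. of_nat (A ! i))) *
      (fps_const (\<Prod>i<length A. of_nat (A ! i)) * fps_X ^ length A)"
    unfolding expansion_at_1_def by (simp only: mult.assoc)
  then show ?thesis using nz by (simp flip: mult.assoc)
qed

lemma expansion_at_1_nth:
  assumes "A \<noteq> []"
  shows "expansion_at_1 A $ j = 1 / (\<Prod>i<length A. of_nat (A ! i)) *
           (\<Sum>js | length js = length A \<and> sum_list js = j.
              (- 1) ^ j * (\<Prod>i<length A. recip_bernoulli (js ! i) (A ! i) / fact (js ! i)))"
proof -
  have coeff: "recip_bernoulli_fps n $ k = (- 1) ^ k * (recip_bernoulli k n / fact k)" for n k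
    by (simp add: recip_bernoulli_def flip: power_mult_distrib mult.assoc)
  have "(\<Prod>i<length A. recip_bernoulli_fps (A ! i) $ (js ! i)) =
      (- 1) ^ j * (\<Prod>i<length A. recip_bernoulli (js ! i) (A ! i) / fact (js ! i))"
    if "length js = length A" "sum_list js = j" for js
  proof -
    have "(\<Sum>i<length A. js ! i) = j"
      using that by (simp add: sum_list_sum_nth lessThan_atLeast0)
    then show ?thesis
      unfolding coeff prod.distrib by (simp flip: power_sum)
  qed
  then show ?thesis
    using assms by (simp add: expansion_at_1_def fps_prod_lessThan_nth)
qed

section \<open>Coefficients of proper fractions with denominator a power of $1 - x^n$\<close>

text \<open>
  The negative binomial series in $x^n$; by Pascal's rule, multiplying the series for the exponent
  $r + 2$ by $1 - x^n$ gives the one for $r + 1$.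
\<close>

lemma inverse_one_minus_X_power_nth:
  assumes "n > 0"
  shows "inverse ((1 - fps_X ^ n) ^ Suc r) =
           Abs_fps (\<lambda>t. if n dvd t then of_nat ((t div n + r) choose r) else (0 :: rat))"
proof (rule fps_inverse_unique)
  define E where "E r = Abs_fps (\<lambda>t. if n dvd t then of_nat ((t div n + r) choose r) else (0 :: rat))" for r
  have step: "(1 - fps_X ^ n) * E (Suc r) = E r" for r
  proof (rule fps_ext)
    fix t
    show "((1 - fps_X ^ n) * E (Suc r)) $ t = E r $ t"
    proof (cases "n dvd t")
      case True
      then obtain k where k: "t = n * k" by blast
      show ?thesis
      proof (cases k)
        case 0
        with k assms show ?thesis
          by (simp add: E_def left_diff_distrib fps_X_power_mult_nth)
      next
        case (Suc l)
        then have "t - n = n * l" "\<not> t < n" using k by simp_all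
        then show ?thesis using assms k Suc
          by (simp add: E_def left_diff_distrib fps_X_power_mult_nth del: mult_Suc_right)
      qed
    next
      case False
      moreover have "\<not> n dvd t - n" if "\<not> t < n"
        using that False by (simp add: dvd_minus_self)
      ultimately show ?thesis
        by (auto simp: E_def left_diff_distrib fps_X_power_mult_nth)
    qed
  qed
  have base: "(1 - fps_X ^ n) * E 0 = 1"
  proof (rule fps_ext)
    fix t
    have "n dvd t - n \<longleftrightarrow> n dvd t" if "n \<le> t"
      using that by (simp add: dvd_minus_self)
    then show "((1 - fps_X ^ n) * E 0) $ t = 1 $ t"
      using assms by (auto simp: E_def left_diff_distrib fps_X_power_mult_nth dest: dvd_imp_le)
  qed
  have "(1 - fps_X ^ n) ^ Suc r * E r = 1" for r
  proof (induction r)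
    case 0
    then show ?case using base by simp
  next
    case (Suc r)
    have "(1 - fps_X ^ n) ^ Suc (Suc r) * E (Suc r) =
            (1 - fps_X ^ n) ^ Suc r * ((1 - fps_X ^ n) * E (Suc r))"
      by (simp only: power_Suc2 mult.assoc)
    also have "\<dots> = 1" unfolding step by (fact Suc)
    finally show ?case .
  qed
  then show "(1 - fps_X ^ n) ^ Suc r *
      Abs_fps (\<lambda>t. if n dvd t then of_nat ((t div n + r) choose r) else (0 :: rat)) = 1"
    by (simp add: E_def)
qed

text \<open>
  The polynomial in $t$ which agrees with $\binom{l + r}{r}$, $l = (t - k)/n$, whenever $n$ divides
  $t - k$ and $l \ge -r$ (both sides vanish for $-r \le l < 0$).
\<close>

definition binomial_branch :: "nat \<Rightarrow> nat \<Rightarrow> nat \<Rightarrow> rat poly" where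
  "binomial_branch n r k =
     smult (1 / fact r) (\<Prod>i<r. [:of_nat (Suc i) - of_nat k / of_nat n, 1 / of_nat n:])"

lemma degree_binomial_branch: "degree (binomial_branch n r k) \<le> r"
proof -
  have "degree (\<Prod>i<r. [:of_nat (Suc i) - of_nat k / of_nat n, 1 / of_nat n :: rat:]) \<le>
          (\<Sum>i<r. 1)"
    by (rule order_trans[OF degree_prod_sum_le]) (auto intro!: sum_mono)
  then show ?thesis unfolding binomial_branch_def
    by (intro order_trans[OF degree_smult_le]) simp
qed

lemma lead_binomial_branch:
  assumes "n > 0"
  shows "coeff (binomial_branch n r k) r = 1 / (of_nat n ^ r * fact r)"
proof -
  define P where "P = (\<Prod>i<r. [:of_nat (Suc i) - of_nat k / of_nat n, 1 / of_nat n :: rat:])"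
  have "degree P = r"
    unfolding P_def using assms by (subst degree_prod_eq_sum_degree) auto
  then have "coeff P r = lead_coeff P" by simp
  also have "\<dots> = (1 / of_nat n) ^ r"
    unfolding P_def lead_coeff_prod using assms by simp
  finally show ?thesis unfolding binomial_branch_def P_def[symmetric]
    by (simp add: power_one_over)
qed

lemma poly_binomial_branch:
  assumes "n > 0" and "t = k + n * l"
  shows "poly (binomial_branch n r k) (of_nat t) = of_nat ((l + r) choose r)"
proof -
  have "poly (binomial_branch n r k) (of_nat t) = (\<Prod>i<r. of_nat (Suc (l + i))) / fact r"
  proof -
    have "of_nat (Suc i) - of_nat k / of_nat n + of_nat t * (1 / of_nat n) = (of_nat (Suc (l + i)) :: rat)" for i
    proof -
      have "of_nat t * (1 / of_nat n) = of_nat k / of_nat n + (of_nat l :: rat)"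
        using assms by (simp add: add_divide_distrib)
      then show ?thesis by simp
    qed
    then show ?thesis
      unfolding binomial_branch_def by (simp add: poly_prod del: of_nat_Suc)
  qed
  also have "(\<Prod>i<r. of_nat (Suc (l + i)) :: rat) = pochhammer (of_nat (Suc l)) r"
    by (simp add: pochhammer_prod lessThan_atLeast0 algebra_simps del: of_nat_Suc flip: of_nat_add)
  also have "\<dots> / fact r = of_nat ((l + r) choose r)"
    by (simp add: binomial_gbinomial gbinomial_pochhammer' add.commute)
  finally show ?thesis .
qed

lemma poly_binomial_branch_0:
  assumes "n > 0" and "k = t + n * l" and "0 < l" and "l \<le> r"
  shows "poly (binomial_branch n r k) (of_nat t) = 0"
proof -
  have "of_nat (Suc (l - 1)) - of_nat k / of_nat n + of_nat t * (1 / of_nat n) = (0 :: rat)"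
  proof -
    have "of_nat k / of_nat n = of_nat t * (1 / of_nat n) + (of_nat l :: rat)"
      using assms by (simp add: add_divide_distrib)
    then show ?thesis using assms(3) by simp
  qed
  then have "\<exists>i\<in>{..<r}. of_nat (Suc i) - of_nat k / of_nat n + of_nat t * (1 / of_nat n) = (0 :: rat)"
    using assms by (intro bexI[of _ "l - 1"]) auto
  then show ?thesis
    unfolding binomial_branch_def by (simp add: poly_prod del: of_nat_Suc)
qed

text \<open>
  The indices $k > t$ of the residue class of $t$ do not occur in the convolution, but the bound on
  the degree keeps $k - t$ within the range where the weight polynomial vanishes.  Including them
  makes the range of summation depend on $t$ only through its residue class.
\<close>

lemma coeff_proper_fraction:
  assumes n: "n > 0" and deg: "degree g < n * Suc r"
  shows "(fps_of_poly g * inverse ((1 - fps_X ^ n) ^ Suc r)) $ t =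
           (\<Sum>k | k < n * Suc r \<and> k mod n = t mod n.
              coeff g k * poly (binomial_branch n r k) (of_nat t))"
proof -
  let ?N = "n * Suc r"
  have "(fps_of_poly g * inverse ((1 - fps_X ^ n) ^ Suc r)) $ t =
      (\<Sum>k\<le>t. coeff g k * (if n dvd t - k then of_nat (((t - k) div n + r) choose r) else 0))"
    unfolding inverse_one_minus_X_power_nth[OF n] by (simp add: fps_mult_nth atLeast0AtMost)
  also have "\<dots> = (\<Sum>k | k \<le> t \<and> k < ?N \<and> k mod n = t mod n.
      coeff g k * poly (binomial_branch n r k) (of_nat t))"
  proof (rule sum.mono_neutral_cong_right)
    show "\<forall>k\<in>{..t} - {k. k \<le> t \<and> k < ?N \<and> k mod n = t mod n}.
        coeff g k * (if n dvd t - k then of_nat (((t - k) div n + r) choose r) else 0) = 0"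
    proof
      fix k assume k: "k \<in> {..t} - {k. k \<le> t \<and> k < ?N \<and> k mod n = t mod n}"
      then consider "k \<ge> ?N" | "k \<le> t" "k mod n \<noteq> t mod n" by force
      then show "coeff g k * (if n dvd t - k then of_nat (((t - k) div n + r) choose r) else 0) = 0"
      proof cases
        case 1
        then show ?thesis using deg by (simp add: coeff_eq_0)
      next
        case 2
        then show ?thesis using mod_eq_dvd_iff_nat[of k t n] by auto
      qed
    qed
  next
    fix k assume k: "k \<in> {k. k \<le> t \<and> k < ?N \<and> k mod n = t mod n}"
    then have dvd: "n dvd t - k" using mod_eq_dvd_iff_nat[of k t n] by auto
    then obtain l where l: "t - k = n * l" by blast
    then have "t = k + n * l" using k by auto
    then show "coeff g k * (if n dvd t - k then of_nat (((t - k) div n + r) choose r) else 0) =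
        coeff g k * poly (binomial_branch n r k) (of_nat t)"
      using dvd l n by (simp add: poly_binomial_branch del: of_nat_add)
  qed auto
  also have "\<dots> = (\<Sum>k | k < ?N \<and> k mod n = t mod n.
      coeff g k * poly (binomial_branch n r k) (of_nat t))"
  proof (rule sum.mono_neutral_left)
    show "\<forall>k\<in>{k. k < ?N \<and> k mod n = t mod n} - {k. k \<le> t \<and> k < ?N \<and> k mod n = t mod n}.
        coeff g k * poly (binomial_branch n r k) (of_nat t) = 0"
    proof
      fix k assume "k \<in> {k. k < ?N \<and> k mod n = t mod n} - {k. k \<le> t \<and> k < ?N \<and> k mod n = t mod n}"
      then have k: "t < k" "k < ?N" "k mod n = t mod n" by auto
      then have "n dvd k - t" using mod_eq_dvd_iff_nat[of t k n] by auto
      then obtain l where "k - t = n * l" by blast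
      then have l: "k = t + n * l" using k by auto
      then have "n * l < n * Suc r" using k(2) by linarith
      then have "l < Suc r" using n mult_less_cancel1[of n l "Suc r"] by blast
      then have "l \<le> r" by simp
      moreover have "0 < l" using l k(1) by (cases l) auto
      ultimately show "coeff g k * poly (binomial_branch n r k) (of_nat t) = 0"
        using poly_binomial_branch_0[OF n l] by simp
    qed
  qed auto
  finally show ?thesis .
qed

section \<open>Leading coefficients and roots of unity\<close>

lemma unit_root_power:
  "unit_root n ^ k = cis (2 * pi * real k / real n)"
  by (simp add: unit_root_def cis_conv_exp exp_of_nat_mult[symmetric] field_simps)

lemma unit_root_power_eq_1_iff:
  assumes "n > 0"
  shows "unit_root n ^ k = 1 \<longleftrightarrow> n dvd k"
proof
  assume "n dvd k"
  then obtain l where "k = n * l" by blast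
  then show "unit_root n ^ k = 1"
    using assms by (simp add: unit_root_power)
      (metis cis_multiple_2pi Ints_of_nat mult.assoc)
next
  assume 1: "unit_root n ^ k = 1"
  then have "cos (2 * pi * real k / real n) = 1"
    unfolding unit_root_power by (metis cis.sel(1) one_complex.sel(1))
  then obtain x :: int where "2 * pi * real k / real n = of_int x * 2 * pi"
    by (auto simp: cos_one_2pi_int)
  then have "real k = of_int x * real n"
    using assms by (simp add: field_simps)
  then have "int k = x * int n"
    by (metis of_int_eq_iff of_int_mult of_int_of_nat_eq)
  then show "n dvd k"
    by (metis dvd_triv_right int_dvd_int_iff)
qed

lemma sum_unit_root_powers:
  assumes "n > 0"
  shows "(\<Sum>\<alpha><n. unit_root n powi (int \<alpha> * c)) = (if int n dvd c then of_nat n else 0)"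
proof -
  define z where "z = unit_root n powi c"
  have 1: "z = 1 \<longleftrightarrow> int n dvd c"
  proof (cases "c \<ge> 0")
    case True
    then obtain k where "c = int k" using nonneg_int_cases by blast
    then show ?thesis using unit_root_power_eq_1_iff[OF assms] by (simp add: z_def)
  next
    case False
    then obtain k where "c = - int k" by (metis int_cases2 of_nat_0_le_iff)
    then show ?thesis using unit_root_power_eq_1_iff[OF assms, of k] by (simp add: z_def power_int_minus)
  qed
  have "z ^ n = (unit_root n ^ n) powi c"
    by (simp add: z_def power_int_power power_int_power' mult.commute)
  then have zn: "z ^ n = 1" using unit_root_power_eq_1_iff[OF assms, of n] by simp
  have "(\<Sum>\<alpha><n. unit_root n powi (int \<alpha> * c)) = (\<Sum>\<alpha><n. z ^ \<alpha>)"
    by (simp add: z_def power_int_power' mult.commute)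
  also have "\<dots> = (if int n dvd c then of_nat n else 0)"
    using zn 1 by (auto simp: sum_gp_strict)
  finally show ?thesis .
qed

text \<open>
  Exchanging the sums, the orthogonality of the characters of $\<int>/n$ selects the exponents
  congruent to $t$.
\<close>

lemma sum_coeffs_in_residue_class:
  fixes g :: "complex poly"
  assumes n: "n > 0" and deg: "degree g < N"
  shows "(\<Sum>\<alpha><n. poly g (unit_root n ^ \<alpha>) * unit_root n powi (- int (\<alpha> * t)))
       = of_nat n * (\<Sum>k | k < N \<and> k mod n = t mod n. coeff g k)"
proof -
  have nz: "unit_root n \<noteq> 0" by (simp add: unit_root_def)
  have "(\<Sum>\<alpha><n. poly g (unit_root n ^ \<alpha>) * unit_root n powi (- int (\<alpha> * t))) =
      (\<Sum>\<alpha><n. \<Sum>k<N. coeff g k * unit_root n powi (int \<alpha> * (int k - int t)))"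
  proof (rule sum.cong[OF refl])
    fix \<alpha> assume "\<alpha> \<in> {..<n}"
    have "poly g (unit_root n ^ \<alpha>) = (\<Sum>k<N. coeff g k * (unit_root n ^ \<alpha>) ^ k)"
      unfolding poly_altdef using deg
      by (intro sum.mono_neutral_left) (auto simp: coeff_eq_0)
    then have "poly g (unit_root n ^ \<alpha>) * unit_root n powi (- int (\<alpha> * t)) =
        (\<Sum>k<N. coeff g k * ((unit_root n ^ \<alpha>) ^ k * unit_root n powi (- int (\<alpha> * t))))"
      by (simp add: sum_distrib_right mult.assoc)
    moreover have "(unit_root n ^ \<alpha>) ^ k * unit_root n powi (- int (\<alpha> * t)) =
        unit_root n powi (int \<alpha> * (int k - int t))" for k
    proof -
      have "(unit_root n ^ \<alpha>) ^ k = unit_root n powi (int (\<alpha> * k))"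
        by (simp only: power_int_of_nat power_mult)
      then show ?thesis
        using power_int_add[of "unit_root n" "int (\<alpha> * k)" "- int (\<alpha> * t)"] nz
        by (simp add: right_diff_distrib)
    qed
    ultimately show "poly g (unit_root n ^ \<alpha>) * unit_root n powi (- int (\<alpha> * t)) =
        (\<Sum>k<N. coeff g k * unit_root n powi (int \<alpha> * (int k - int t)))"
      by (simp only:)
  qed
  also have "\<dots> = (\<Sum>k<N. coeff g k * (\<Sum>\<alpha><n. unit_root n powi (int \<alpha> * (int k - int t))))"
    by (subst sum.swap) (simp add: sum_distrib_left)
  also have "\<dots> = (\<Sum>k<N. if k mod n = t mod n then of_nat n * coeff g k else 0)"
  proof (rule sum.cong[OF refl])
    fix k
    have "int n dvd int k - int t \<longleftrightarrow> k mod n = t mod n"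
      by (metis mod_eq_dvd_iff of_nat_eq_iff of_nat_mod)
    then show "coeff g k * (\<Sum>\<alpha><n. unit_root n powi (int \<alpha> * (int k - int t))) =
        (if k mod n = t mod n then of_nat n * coeff g k else 0)"
      by (simp add: sum_unit_root_powers[OF n])
  qed
  also have "\<dots> = (\<Sum>k\<in>{k\<in>{..<N}. k mod n = t mod n}. of_nat n * coeff g k)"
    by (rule sum.inter_filter[symmetric]) simp
  finally show ?thesis by (simp add: sum_distrib_left)
qed

definition eval_at :: "complex \<Rightarrow> rat poly \<Rightarrow> complex" where
  "eval_at z f = poly (map_poly of_rat f) z"

lemma eval_at_0 [simp]: "eval_at z 0 = 0"
  by (simp add: eval_at_def)

lemma eval_at_pCons: "eval_at z (pCons a f) = of_rat a + z * eval_at z f"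
  by (simp add: eval_at_def map_poly_pCons)

lemma eval_at_1 [simp]: "eval_at z 1 = 1"
  by (simp add: one_pCons eval_at_pCons)

lemma eval_at_add: "eval_at z (f + g) = eval_at z f + eval_at z g"
proof (induction f arbitrary: g)
  case (pCons a f)
  show ?case by (cases g) (simp add: eval_at_pCons of_rat_add pCons.IH ring_distribs)
qed simp

lemma eval_at_smult: "eval_at z (smult c f) = of_rat c * eval_at z f"
  by (induction f) (simp_all add: eval_at_pCons of_rat_mult algebra_simps)

lemma eval_at_mult: "eval_at z (f * g) = eval_at z f * eval_at z g"
  by (induction f) (simp_all add: eval_at_pCons eval_at_add eval_at_smult mult_pCons_left algebra_simps)

lemma eval_at_diff: "eval_at z (f - g) = eval_at z f - eval_at z g"
  using eval_at_add[of z "f - g" g] by simp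

lemma eval_at_power: "eval_at z (f ^ n) = eval_at z f ^ n"
  by (induction n) (simp_all add: eval_at_mult)

lemma eval_at_prod: "eval_at z (prod f I) = (\<Prod>i\<in>I. eval_at z (f i))"
  by (induction I rule: infinite_finite_induct) (simp_all add: eval_at_mult)

lemma eval_at_one_minus_monom: "eval_at z (1 - monom 1 n) = 1 - z ^ n"
proof -
  have "eval_at z (monom 1 n) = z ^ n"
    by (induction n) (simp_all add: monom_0 monom_Suc eval_at_pCons)
  then show ?thesis by (simp add: eval_at_diff)
qed

text \<open>
  The coefficients of the quasi-polynomial are sums over a residue class of products of a
  coefficient of $g$ with one of the weight polynomial.  The top coefficient of the weight does not
  depend on $k$, so the top coefficient of the quasi-polynomial is a constant multiple of the sum of
  the coefficients of $g$ over the residue class of $t$.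
\<close>

lemma rational_function_quasi_polynomial:
  fixes g :: "rat poly"
  assumes n: "n > 0" and deg: "degree g < n * Suc r"
  defines "f \<equiv> \<lambda>t. (fps_of_poly g * inverse ((1 - fps_X ^ n) ^ Suc r)) $ t"
  obtains \<alpha> :: "nat \<Rightarrow> nat \<Rightarrow> rat"
  where "\<And>i t. \<alpha> i (t + n) = \<alpha> i t"
    and "\<And>t. f t = (\<Sum>i<Suc r. \<alpha> i t * of_nat t ^ i)"
    and "\<And>t. of_rat (\<alpha> r t) = 1 / (of_nat n ^ Suc r * fact r) *
           (\<Sum>a<n. eval_at (unit_root n ^ a) g * unit_root n powi (- int (a * t)))"
proof
  let ?K = "\<lambda>t. {k. k < n * Suc r \<and> k mod n = t mod n}"
  define \<alpha> where "\<alpha> i t = (\<Sum>k\<in>?K t. coeff g k * coeff (binomial_branch n r k) i)" for i t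
  show "\<alpha> i (t + n) = \<alpha> i t" for i t
    by (simp add: \<alpha>_def)
  show "f t = (\<Sum>i<Suc r. \<alpha> i t * of_nat t ^ i)" for t
  proof -
    have "poly (binomial_branch n r k) x = (\<Sum>i<Suc r. coeff (binomial_branch n r k) i * x ^ i)" for k x
      unfolding poly_altdef using degree_binomial_branch[of n r k]
      by (intro sum.mono_neutral_left) (auto simp: coeff_eq_0)
    then have "f t = (\<Sum>k\<in>?K t. \<Sum>i<Suc r. coeff g k * coeff (binomial_branch n r k) i * of_nat t ^ i)"
      unfolding f_def coeff_proper_fraction[OF n deg]
      by (simp only: sum_distrib_left mult.assoc)
    also have "\<dots> = (\<Sum>i<Suc r. \<alpha> i t * of_nat t ^ i)"
      unfolding \<alpha>_def sum_distrib_right by (rule sum.swap)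
    finally show ?thesis .
  qed
  show "of_rat (\<alpha> r t) = 1 / (of_nat n ^ Suc r * fact r) *
           (\<Sum>a<n. eval_at (unit_root n ^ a) g * unit_root n powi (- int (a * t)))" for t
  proof -
    define G where "G = (map_poly of_rat g :: complex poly)"
    have G: "coeff G k = of_rat (coeff g k)" for k
      by (simp add: G_def coeff_map_poly)
    have degG: "degree G < n * Suc r"
      using degree_le[of "degree g" G] deg by (simp add: G coeff_eq_0)
    have "\<alpha> r t = 1 / (of_nat n ^ r * fact r) * (\<Sum>k\<in>?K t. coeff g k)"
      by (simp add: \<alpha>_def lead_binomial_branch[OF n] sum_divide_distrib)
    moreover have "of_rat (fact r) = (fact r :: complex)"
      by (metis of_nat_fact of_rat_of_nat_eq)
    ultimately have "of_rat (\<alpha> r t) = 1 / (of_nat n ^ r * fact r) * (\<Sum>k\<in>?K t. coeff G k)"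
      by (simp add: of_rat_mult of_rat_divide of_rat_power of_rat_sum G)
    also have "(\<Sum>k\<in>?K t. coeff G k) =
        (\<Sum>a<n. eval_at (unit_root n ^ a) g * unit_root n powi (- int (a * t))) / of_nat n"
      using sum_coeffs_in_residue_class[OF n degG, of t] n by (simp add: eval_at_def G_def)
    finally show ?thesis by simp
  qed
qed

text \<open>
  Periodic coefficients take finitely many values, so they are bounded.  For $r = 0$ the sum is
  empty and the exponent is $-1$.
\<close>

lemma periodic_coefficients_bigo:
  fixes \<alpha> :: "nat \<Rightarrow> nat \<Rightarrow> rat"
  assumes n: "n > 0" and per: "\<And>i t. i < r \<Longrightarrow> \<alpha> i (t + n) = \<alpha> i t"
  shows "(\<lambda>t. \<Sum>i<r. of_rat (\<alpha> i t) * of_nat t ^ i :: complex)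
           \<in> O(\<lambda>t. of_nat t powi (int (Suc r) - 2))"
proof (rule big_sum_in_bigo)
  fix i assume "i \<in> {..<r}"
  then have i: "i < r" by simp
  have mod: "\<alpha> i t = \<alpha> i (t mod n)" for t
  proof -
    have "\<alpha> i (s + n * l) = \<alpha> i s" for s l
    proof (induction l)
      case (Suc l)
      have "s + n * Suc l = (s + n * l) + n" by simp
      then show ?case using Suc per[OF i, of "s + n * l"] by (simp only:)
    qed simp
    from this[of "t mod n" "t div n"] show ?thesis by simp
  qed
  define C where "C = Max ((\<lambda>t. norm (of_rat (\<alpha> i t) :: complex)) ` {..<n})"
  have C: "norm (of_rat (\<alpha> i t) :: complex) \<le> C" for t
    unfolding C_def by (subst mod, rule Max_ge) (use n in auto)
  show "(\<lambda>t. of_rat (\<alpha> i t) * of_nat t ^ i :: complex) \<in> O(\<lambda>t. of_nat t powi (int (Suc r) - 2))"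
  proof (rule bigoI)
    show "\<forall>\<^sub>F t in sequentially. norm (of_rat (\<alpha> i t) * of_nat t ^ i :: complex)
            \<le> C * norm (of_nat t powi (int (Suc r) - 2) :: complex)"
      using eventually_ge_at_top[of 1]
    proof eventually_elim
      case (elim t)
      have "int (Suc r) - 2 = int (r - 1)" using i by simp
      then have "(of_nat t powi (int (Suc r) - 2) :: complex) = of_nat t ^ (r - 1)"
        by (simp only: power_int_of_nat)
      moreover have "real t ^ i \<le> real t ^ (r - 1)"
        using i elim by (intro power_increasing) auto
      ultimately show ?case
        using C[of t] by (auto simp: norm_mult norm_power intro!: mult_mono order_trans[OF norm_ge_zero C])
    qed
  qed
qed

section \<open>Decomposition of the denumerant into waves\<close>

lemma to_fract_power: "to_fract (x ^ n) = to_fract x ^ n"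
  by (induction n) simp_all

lemma to_fract_prod: "to_fract (prod f I) = (\<Prod>i\<in>I. to_fract (f i))"
  by (induction I rule: infinite_finite_induct) simp_all

text \<open>
  The numerator over $\Psi_{n_j}^{r_j}$ in the partial fraction decomposition.
\<close>

definition wave_fraction :: "rat poly \<Rightarrow> nat \<Rightarrow> nat list \<Rightarrow> nat list \<Rightarrow> nat \<Rightarrow> rat poly" where
  "wave_fraction p m ns rs j =
     eval_mod p
       ((1 - monom 1 1) ^ (m + sum_list rs) *
          (\<Prod>i\<in>{..<length ns} - {j}. Psi (ns ! i) ^ (rs ! i)))
       (Psi (ns ! j) ^ (rs ! j))"

lemma wave_numerator_eq:
  "wave_numerator p m ns rs j = (1 - monom 1 1) ^ (rs ! j) * wave_fraction p m ns rs j"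
  by (simp add: wave_numerator_def wave_fraction_def)

lemma fps_of_poly_one_minus_monom: "fps_of_poly (1 - monom 1 n) = (1 - fps_X ^ n :: rat fps)"
  by (simp add: fps_of_poly_diff fps_of_poly_monom)

lemma Psi_nth_0: "n > 0 \<Longrightarrow> fps_of_poly (Psi n ^ r) $ 0 = 1"
proof -
  assume "n > 0"
  then have "coeff (Psi n) 0 = 1"
    by (simp add: Psi_def coeff_sum coeff_monom if_distrib cong: if_cong)
  then show ?thesis by (simp add: coeff_0_power)
qed

text \<open>
  The factor $(1 - x)^{r_j}$ of the wave numerator cancels against the same factor of
  $(1 - x^{n_j})^{r_j}$.
\<close>

lemma wave_eq_fraction_coeff:
  assumes "ns ! j > 0"
  shows "wave p m ns rs j t =
    (fps_of_poly (wave_fraction p m ns rs j) * inverse (fps_of_poly (Psi (ns ! j) ^ (rs ! j)))) $ t"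
proof -
  let ?n = "ns ! j" and ?r = "rs ! j"
  let ?P = "fps_of_poly (Psi ?n ^ ?r)" and ?Y = "(1 - fps_X) ^ ?r :: rat fps"
  have nz: "(1 - fps_X ^ ?n :: rat fps) ^ ?r $ 0 \<noteq> 0"
    using assms by (simp add: fps_nth_power_0 zero_power)
  have q1: "fps_of_poly (1 - monom 1 1 :: rat poly) = 1 - fps_X"
    unfolding fps_of_poly_one_minus_monom by simp
  have "(1 - fps_X ^ ?n :: rat fps) = (1 - fps_X) * fps_of_poly (Psi ?n)"
    by (simp only: fps_of_poly_one_minus_monom[symmetric] one_minus_monom_eq_Psi[of ?n] fps_of_poly_mult q1)
  then have denom: "(1 - fps_X ^ ?n) ^ ?r = ?Y * ?P"
    by (simp only: power_mult_distrib fps_of_poly_power)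
  have inv: "?Y * inverse ?Y = 1"
    by (rule inverse_mult_eq_1') (simp add: fps_nth_power_0)
  have numer: "fps_of_poly (wave_numerator p m ns rs j) =
      ?Y * fps_of_poly (wave_fraction p m ns rs j)"
    by (simp only: wave_numerator_eq fps_of_poly_mult fps_of_poly_power q1)
  have "fps_of_poly (wave_numerator p m ns rs j) / (1 - fps_X ^ ?n) ^ ?r =
      ?Y * fps_of_poly (wave_fraction p m ns rs j) * (inverse ?Y * inverse ?P)"
    unfolding fps_divide_unit[OF nz] unfolding numer denom fps_inverse_mult ..
  also have "\<dots> = (?Y * inverse ?Y) * (fps_of_poly (wave_fraction p m ns rs j) * inverse ?P)"
    by (simp only: mult_ac)
  finally show ?thesis
    unfolding wave_def inv by simp
qed

text \<open>
  The hypotheses on the factorization, with the identity of rational functions replaced by the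
  polynomial identity obtained from it by cross-multiplication.
\<close>

locale denumerant_factorization =
  fixes A ns rs :: "nat list" and m :: nat and p :: "rat poly"
  assumes A_pos: "\<And>a. a \<in> set A \<Longrightarrow> a > 0"
    and A_nonempty: "A \<noteq> []"
    and len: "length rs = length ns"
    and ns_pos: "\<And>i. i < length ns \<Longrightarrow> ns ! i > 0"
    and rs_pos: "\<And>i. i < length ns \<Longrightarrow> rs ! i > 0"
    and ns_coprime: "\<And>i j. i < length ns \<Longrightarrow> j < length ns \<Longrightarrow> i \<noteq> j \<Longrightarrow> coprime (ns ! i) (ns ! j)"
    and factorization:
      "p * (\<Prod>i<length A. 1 - monom 1 (A ! i)) =
         (1 - monom 1 1) ^ m * (\<Prod>j<length ns. (1 - monom 1 (ns ! j)) ^ (rs ! j))"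
begin

abbreviation Q :: "nat \<Rightarrow> rat poly" where
  "Q j \<equiv> Psi (ns ! j) ^ (rs ! j)"

abbreviation M :: "rat poly" where
  "M \<equiv> (1 - monom 1 1) ^ (m + sum_list rs)"

abbreviation I :: "nat set" where
  "I \<equiv> {..<length ns}"

abbreviation e :: "nat \<Rightarrow> rat poly" where
  "e \<equiv> wave_fraction p m ns rs"

lemma denominator_eq: "p * (\<Prod>i<length A. 1 - monom 1 (A ! i)) = M * prod Q I"
proof -
  have "(\<Prod>j\<in>I. (1 - monom 1 (ns ! j) :: rat poly) ^ (rs ! j)) =
      (\<Prod>j\<in>I. (1 - monom 1 1) ^ (rs ! j)) * prod Q I"
    by (subst one_minus_monom_eq_Psi) (simp only: power_mult_distrib prod.distrib)
  also have "(\<Prod>j\<in>I. (1 - monom 1 1 :: rat poly) ^ (rs ! j)) = (1 - monom 1 1) ^ sum_list rs"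
    using len by (simp add: power_sum[symmetric] sum_list_sum_nth lessThan_atLeast0)
  finally show ?thesis
    unfolding factorization by (simp only: power_add mult.assoc)
qed

lemma Q_nonzero: "j < length ns \<Longrightarrow> Q j \<noteq> 0"
  using ns_pos Psi_nonzero by simp

lemma M_nonzero: "M \<noteq> 0"
  using one_minus_monom_nonzero[of 1] by simp

lemma numerator_degree: "degree p < degree (M * prod Q I)"
proof -
  have A_nz: "1 - monom 1 (A ! i) \<noteq> (0 :: rat poly)" if "i < length A" for i
    using A_pos that by (intro one_minus_monom_nonzero) simp
  have "M * prod Q I \<noteq> 0" using M_nonzero Q_nonzero by simp
  then have p: "p \<noteq> 0" unfolding denominator_eq[symmetric] by auto
  have "degree (\<Prod>i<length A. 1 - monom 1 (A ! i) :: rat poly) = (\<Sum>i<length A. A ! i)"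
    using A_nz by (subst degree_prod_eq_sum_degree) (auto simp: degree_one_minus_monom)
  moreover have "(\<Sum>i<length A. A ! i) > 0"
    using A_nonempty A_pos by (intro sum_pos) auto
  moreover have "(\<Prod>i<length A. 1 - monom 1 (A ! i)) \<noteq> (0 :: rat poly)"
    using A_nz by simp
  ultimately show ?thesis
    unfolding denominator_eq[symmetric] using p by (simp add: degree_mult_eq)
qed

lemma e_cong: "j < length ns \<Longrightarrow> [e j * (M * prod Q (I - {j})) = p] (mod Q j)"
proof -
  assume j: "j < length ns"
  have "coprime (M * prod Q (I - {j})) (Q j)"
    unfolding coprime_mult_left_iff
  proof
    show "coprime M (Q j)"
      using ns_pos[OF j] by (intro coprime_power_left_iff[THEN iffD2] disjI1
          coprime_one_minus_x) (simp add: poly_Psi_1 poly_power)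
    show "coprime (prod Q (I - {j})) (Q j)"
    proof (rule prod_coprime_left)
      fix i assume "i \<in> I - {j}"
      then show "coprime (Q i) (Q j)"
        using j ns_coprime[of i j] ns_pos[of i] by (simp add: coprime_Psi)
    qed
  qed
  then show ?thesis unfolding wave_fraction_def by (rule eval_mod_cong)
qed

lemma e_degree: "j < length ns \<Longrightarrow> e j = 0 \<or> degree (e j) < degree (Q j)"
  using Q_nonzero unfolding wave_fraction_def by (intro eval_mod_degree) auto

text \<open>
  The partial fraction decomposition read coefficientwise, with the polar part at 1 replaced by its
  expansion in negative powers of $1 - x$.
\<close>

lemma denumerant_decomposition:
  "of_nat (denumerant t A) =
     (\<Sum>j<length A. expansion_at_1 A $ j * of_nat ((t + length A - j - 1) choose t)) +
     (\<Sum>j<length ns. wave p m ns rs j t)"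
proof -
  let ?r = "length A" and ?N = "m + sum_list rs" and ?U = "prod Q I"
  define R where "R = (\<Sum>i\<in>I. e i * prod Q (I - {i}))"
  have cop: "coprime (Q i) (Q j)" if "i \<in> I" "j \<in> I" "i \<noteq> j" for i j
    using that ns_coprime[of i j] ns_pos[of i] by (simp add: coprime_Psi)
  obtain h where p_sum: "p = (\<Sum>i\<in>I. e i * (M * prod Q (I - {i}))) + h * ?U"
    and h: "h = 0 \<or> degree h < degree M"
  proof (rule partial_fraction_decomposition[of I Q e M p])
    show "degree p < degree (M * prod Q I)" by (rule numerator_degree)
  qed (use cop e_cong e_degree M_nonzero Q_nonzero in auto)
  have deg_M: "degree M = ?N"
    using degree_one_minus_monom[of 1] one_minus_monom_nonzero[of 1] by (subst degree_power_eq) simp_all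
  have p_R: "p = R * (1 - monom 1 1) ^ ?N + h * ?U"
    unfolding R_def sum_distrib_right by (subst p_sum) (simp only: mult_ac)
  have U1: "poly ?U 1 \<noteq> 0"
    using ns_pos by (simp add: poly_prod poly_Psi_1)
  have "taylor1 p * fps_X ^ ?r =
      taylor1 p * (\<Prod>i<?r. 1 - (1 - fps_X) ^ (A ! i)) * expansion_at_1 A"
    using expansion_at_1_mult[of A] A_pos by (simp add: mult.assoc mult.commute)
  also have "taylor1 p * (\<Prod>i<?r. 1 - (1 - fps_X) ^ (A ! i)) = fps_X ^ ?N * taylor1 ?U"
    using arg_cong[OF denominator_eq, of taylor1] taylor1_one_minus_monom[of 1]
    by (simp add: taylor1_mult taylor1_prod taylor1_power taylor1_one_minus_monom)
  finally have loc: "taylor1 p * fps_X ^ ?r = fps_X ^ ?N * taylor1 ?U * expansion_at_1 A" .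
  have polar: "fps_of_poly h * inverse ((1 - fps_X) ^ ?N) =
      (\<Sum>j<?r. fps_const (expansion_at_1 A $ j) * inverse ((1 - fps_X) ^ (?r - j)))"
    using polar_part_at_1[OF p_R U1 h[unfolded deg_M] loc] .
  define FM where "FM = fps_of_poly M"
  define FQ where "FQ i = fps_of_poly (Q i)" for i
  have FM: "FM = (1 - fps_X) ^ ?N"
    using fps_of_poly_one_minus_monom[of 1] by (simp add: FM_def fps_of_poly_power)
  have inv_FM: "inverse FM * FM = 1"
    unfolding FM by (rule inverse_mult_eq_1) (simp add: fps_nth_power_0)
  have inv_FQ: "inverse (FQ i) * FQ i = 1" if "i \<in> I" for i
    unfolding FQ_def using Psi_nth_0[of "ns ! i" "rs ! i"] ns_pos[of i] that
    by (intro inverse_mult_eq_1) simp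
  have FU_split: "prod FQ I = FQ i * prod FQ (I - {i})" if "i \<in> I" for i
    using that by (intro prod.remove) auto
  define d where "d = Abs_fps (\<lambda>t. of_nat (denumerant t A) :: rat)"
  \<comment> \<open>To show that \<open>d\<close> equals \<open>s\<close>, both are multiplied by the common denominator.\<close>
  define s where "s = fps_of_poly h * inverse FM + (\<Sum>i\<in>I. fps_of_poly (e i) * inverse (FQ i))"
  have "d * (FM * prod FQ I) = d * (fps_of_poly p * (\<Prod>i<?r. 1 - fps_X ^ (A ! i)))"
    using arg_cong[OF denominator_eq, of fps_of_poly]
    by (simp add: fps_of_poly_mult fps_of_poly_prod fps_of_poly_one_minus_monom FM_def FQ_def)
  also have "\<dots> = fps_of_poly p"
    using denumerant_generating_function[of A] A_pos by (simp add: d_def mult.left_commute)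
  also have "\<dots> = (\<Sum>i\<in>I. fps_of_poly (e i) * (FM * prod FQ (I - {i}))) + fps_of_poly h * prod FQ I"
    by (subst p_sum) (simp add: fps_of_poly_add fps_of_poly_sum fps_of_poly_mult fps_of_poly_prod FM_def FQ_def)
  also have "\<dots> = s * (FM * prod FQ I)"
  proof -
    have "fps_of_poly (e i) * inverse (FQ i) * (FM * prod FQ I) =
        fps_of_poly (e i) * (FM * prod FQ (I - {i}))" if "i \<in> I" for i
    proof -
      have "fps_of_poly (e i) * inverse (FQ i) * (FM * prod FQ I) =
          (inverse (FQ i) * FQ i) * (fps_of_poly (e i) * (FM * prod FQ (I - {i})))"
        unfolding FU_split[OF that] by (simp only: mult_ac)
      then show ?thesis unfolding inv_FQ[OF that] by simp
    qed
    moreover have "fps_of_poly h * inverse FM * (FM * prod FQ I) = fps_of_poly h * prod FQ I"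
    proof -
      have "fps_of_poly h * inverse FM * (FM * prod FQ I) = (inverse FM * FM) * (fps_of_poly h * prod FQ I)"
        by (simp only: mult_ac)
      then show ?thesis unfolding inv_FM by simp
    qed
    ultimately show ?thesis
      unfolding s_def distrib_right sum_distrib_right by (simp only: add.commute cong: sum.cong)
  qed
  finally have "d * (FM * prod FQ I) = s * (FM * prod FQ I)" .
  moreover have "FM * prod FQ I \<noteq> 0"
  proof -
    have "FQ i \<noteq> 0" if "i \<in> I" for i
      using inv_FQ[OF that] by (metis mult_zero_right zero_neq_one)
    moreover have "FM \<noteq> 0" using inv_FM by (metis mult_zero_right zero_neq_one)
    ultimately show ?thesis by simp
  qed
  ultimately have "d = s" by simp
  then have "of_nat (denumerant t A) = s $ t"
    by (simp add: d_def flip: \<open>d = s\<close>)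
  also have "s $ t = (fps_of_poly h * inverse FM) $ t + (\<Sum>j<length ns. wave p m ns rs j t)"
    using ns_pos by (simp add: s_def fps_sum_nth wave_eq_fraction_coeff FQ_def)
  also have "(fps_of_poly h * inverse FM) $ t =
      (\<Sum>j<?r. expansion_at_1 A $ j * of_nat ((t + ?r - j - 1) choose t))"
    unfolding FM polar fps_sum_nth
  proof (rule sum.cong[OF refl])
    fix j assume "j \<in> {..<?r}"
    then obtain k where k: "?r - j = Suc k"
      by (metis Suc_diff_Suc lessThan_iff)
    then have "t + ?r - j - 1 = t + k" by simp
    moreover have "(t + k) choose k = (t + k) choose t"
      using binomial_symmetric[of k "t + k"] by simp
    moreover have "inverse ((1 - fps_X) ^ Suc k) $ t = (of_nat ((t + k) choose k) :: rat)"
      using inverse_one_minus_X_power_nth[of 1 k] by simp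
    ultimately show "(fps_const (expansion_at_1 A $ j) * inverse ((1 - fps_X) ^ (?r - j))) $ t =
        expansion_at_1 A $ j * of_nat ((t + ?r - j - 1) choose t)"
      unfolding k by simp
  qed
  finally show ?thesis .
qed

text \<open>
  At a root $z \ne 1$ of $x^{n_j} - 1$ the modulus $\Psi_{n_j}^{r_j}$ vanishes, and the congruence
  that determines the partial fraction numerator turns into an equation between values.  The other
  factors $1 - z^{n_i}$ are nonzero because $n_j$ is coprime to $n_i$.
\<close>

lemma wave_numerator_at_root:
  assumes j: "j < length ns" and a: "0 < a" "a < ns ! j"
  defines "z \<equiv> unit_root (ns ! j) ^ a"
  shows "eval_at z (wave_numerator p m ns rs j) =
     eval_at z p / ((1 - z) ^ m * (\<Prod>i\<in>I - {j}. (1 - z ^ (ns ! i)) ^ (rs ! i)))"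
proof -
  let ?n = "ns ! j"
  note n = ns_pos[OF j]
  have z_power: "z ^ k = 1 \<longleftrightarrow> ?n dvd a * k" for k
    unfolding z_def power_mult[symmetric] by (rule unit_root_power_eq_1_iff[OF n])
  have "z \<noteq> 1" using z_power[of 1] a by (auto dest: dvd_imp_le)
  have z_i: "1 - z ^ (ns ! i) \<noteq> 0" if "i \<in> I - {j}" for i
  proof -
    have "\<not> ?n dvd a * ns ! i"
      using that j ns_coprime[of j i] a by (auto simp: coprime_dvd_mult_left_iff dest: dvd_imp_le)
    then show ?thesis using z_power[of "ns ! i"] by auto
  qed
  have q1: "eval_at z (1 - monom 1 1) = 1 - z"
    unfolding eval_at_one_minus_monom by simp
  have Psi_z: "1 - z ^ k = (1 - z) * eval_at z (Psi k)" for k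
    by (simp only: eval_at_one_minus_monom[symmetric] one_minus_monom_eq_Psi[of k] eval_at_mult q1)
  have Q_z: "eval_at z (Q j) = 0"
    using Psi_z[of ?n] z_power[of ?n] \<open>z \<noteq> 1\<close> rs_pos[OF j] by (simp add: eval_at_power)
  obtain w where "e j * (M * prod Q (I - {j})) - p = Q j * w"
    using e_cong[OF j] by (auto simp: cong_iff_dvd_diff)
  then have "eval_at z (e j * (M * prod Q (I - {j})) - p) = 0"
    by (simp only: eval_at_mult Q_z mult_zero_left)
  then have "eval_at z p = eval_at z (e j) * ((1 - z) ^ (m + sum_list rs) * eval_at z (prod Q (I - {j})))"
    by (simp only: eval_at_diff[of _ _ p] eval_at_mult eval_at_power q1 right_minus_eq)
  also have "sum_list rs = rs ! j + (\<Sum>i\<in>I - {j}. rs ! i)"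
    using j len by (simp add: sum_list_sum_nth lessThan_atLeast0 sum.remove[of _ j])
  finally have "eval_at z p = (1 - z) ^ (rs ! j) * eval_at z (e j) *
      ((1 - z) ^ m * ((\<Prod>i\<in>I - {j}. (1 - z) ^ (rs ! i)) * (\<Prod>i\<in>I - {j}. eval_at z (Psi (ns ! i)) ^ (rs ! i))))"
    by (simp only: power_add power_sum eval_at_prod eval_at_power mult_ac)
  also have "(\<Prod>i\<in>I - {j}. (1 - z) ^ (rs ! i)) * (\<Prod>i\<in>I - {j}. eval_at z (Psi (ns ! i)) ^ (rs ! i)) =
      (\<Prod>i\<in>I - {j}. (1 - z ^ (ns ! i)) ^ (rs ! i))"
    unfolding prod.distrib[symmetric] power_mult_distrib[symmetric] Psi_z ..
  also have "(1 - z) ^ (rs ! j) * eval_at z (e j) = eval_at z (wave_numerator p m ns rs j)"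
    by (simp only: wave_numerator_eq eval_at_mult eval_at_power q1)
  finally show ?thesis
    using \<open>z \<noteq> 1\<close> z_i by simp
qed

text \<open>
  The root $z = 1$ drops out of the average because the wave numerator has the factor
  $(1 - x)^{r_j}$ with $r_j \ge 1$.
\<close>

lemma wave_quasi_polynomial:
  assumes j: "j < length ns"
  shows "\<exists>\<alpha> :: nat \<Rightarrow> nat \<Rightarrow> rat.
           (\<forall>i t. \<alpha> i (t + ns ! j) = \<alpha> i t) \<and>
           (\<forall>t. wave p m ns rs j t = (\<Sum>i<rs ! j. \<alpha> i t * of_nat t ^ i)) \<and>
           (\<forall>t. of_rat (\<alpha> (rs ! j - 1) t) = wave_lead p m ns rs j t / fact (rs ! j - 1))"
proof -
  let ?n = "ns ! j" and ?g = "wave_numerator p m ns rs j"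
  define r where "r = rs ! j - 1"
  have rs: "rs ! j = Suc r" using rs_pos[OF j] by (simp add: r_def)
  note n = ns_pos[OF j]
  have deg: "degree ?g < ?n * Suc r"
  proof (cases "e j = 0")
    case True
    then show ?thesis using n by (simp add: wave_numerator_eq)
  next
    case False
    have "degree ?g = Suc r + degree (e j)"
      using False one_minus_monom_nonzero[of 1] degree_one_minus_monom[of 1] unfolding wave_numerator_eq rs
      by (subst degree_mult_eq) (simp_all add: degree_power_eq del: power_Suc)
    moreover have "degree (e j) < Suc r * (?n - 1)"
      using e_degree[OF j] False Psi_nonzero[OF n] degree_Psi[OF n]
      by (simp add: rs degree_power_eq del: power_Suc)
    moreover have "Suc r + Suc r * (?n - 1) = ?n * Suc r"
      using n by (cases ?n) simp_all
    ultimately show ?thesis by linarith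
  qed
  from rational_function_quasi_polynomial[OF n deg] obtain \<alpha> :: "nat \<Rightarrow> nat \<Rightarrow> rat" where
    per: "\<And>i t. \<alpha> i (t + ?n) = \<alpha> i t" and
    quasi: "\<And>t. (fps_of_poly ?g * inverse ((1 - fps_X ^ ?n) ^ Suc r)) $ t =
              (\<Sum>i<Suc r. \<alpha> i t * of_nat t ^ i)" and
    lead: "\<And>t. of_rat (\<alpha> r t) = 1 / (of_nat ?n ^ Suc r * fact r) *
              (\<Sum>a<?n. eval_at (unit_root ?n ^ a) ?g * unit_root ?n powi (- int (a * t)))"
    by blast
  have wave: "wave p m ns rs j t = (\<Sum>i<Suc r. \<alpha> i t * of_nat t ^ i)" for t
  proof -
    have nz: "((1 - fps_X ^ ?n) ^ Suc r :: rat fps) $ 0 \<noteq> 0"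
      using n by (simp add: fps_nth_power_0 zero_power del: power_Suc)
    show ?thesis unfolding wave_def rs quasi[symmetric] fps_divide_unit[OF nz] ..
  qed
  have top: "of_rat (\<alpha> r t) = wave_lead p m ns rs j t / fact r" for t
  proof -
    let ?x = "unit_root ?n"
    have "eval_at 1 ?g = 0"
      unfolding wave_numerator_eq eval_at_mult eval_at_power eval_at_one_minus_monom rs by simp
    moreover have "{..<?n} = insert 0 {1..?n - 1}" using n by auto
    ultimately have "(\<Sum>a<?n. eval_at (?x ^ a) ?g * ?x powi (- int (a * t))) =
        (\<Sum>a = 1..?n - 1. eval_at (?x ^ a) ?g * ?x powi (- int (a * t)))"
      by simp
    also have "\<dots> = (\<Sum>a = 1..?n - 1. eval_at (?x ^ a) p * ?x powi (- int (a * t)) /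
        ((1 - ?x ^ a) ^ m * (\<Prod>i\<in>I - {j}. (1 - ?x ^ (a * ns ! i)) ^ (rs ! i))))"
    proof (rule sum.cong[OF refl])
      fix a assume "a \<in> {1..?n - 1}"
      then have a: "0 < a" "a < ?n" by auto
      show "eval_at (?x ^ a) ?g * ?x powi (- int (a * t)) =
          eval_at (?x ^ a) p * ?x powi (- int (a * t)) /
          ((1 - ?x ^ a) ^ m * (\<Prod>i\<in>I - {j}. (1 - ?x ^ (a * ns ! i)) ^ (rs ! i)))"
        unfolding power_mult wave_numerator_at_root[OF j a] times_divide_eq_left ..
    qed
    finally have sum_eq: "(\<Sum>a<?n. eval_at (?x ^ a) ?g * ?x powi (- int (a * t))) = \<dots>" .
    have assoc: "1 / (x * y) * S = 1 / x * S / y" for x y S :: complex by simp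
    show ?thesis
      unfolding lead sum_eq wave_lead_def Let_def eval_at_def[symmetric] rs by (rule assoc)
  qed
  show ?thesis
    unfolding rs diff_Suc_1
  proof (intro exI[of _ \<alpha>] conjI allI)
    show "\<alpha> i (t + ?n) = \<alpha> i t" for i t by (rule per)
  qed (rule wave top)+
qed

end

theorem theorem1p1p3:
  fixes A ns rs :: "nat list" and m :: nat and p :: "rat poly"
  assumes "\<forall>a\<in>set A. a > 0"
    and "Gcd (set A) = 1"
    and "length rs = length ns"
    and "\<forall>n\<in>set ns. n \<ge> 2 \<and> (\<exists>a\<in>set A. n dvd a)"
    and "\<forall>i<length ns. \<forall>j<length ns. i \<noteq> j \<longrightarrow> coprime (ns ! i) (ns ! j)"
    and "\<forall>r\<in>set rs. r \<ge> 1"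
    and "1 / (\<Prod>i<length A. to_fract (1 - monom 1 (A ! i))) =
         to_fract p /
           (to_fract (1 - monom 1 1) ^ m *
            (\<Prod>j<length ns. to_fract (1 - monom 1 (ns ! j)) ^ (rs ! j)))"
  shows "(\<forall>t. of_nat (denumerant t A) =
            1 / (\<Prod>i<length A. of_nat (A ! i)) *
            (\<Sum>j<length A. \<Sum>js | length js = length A \<and> sum_list js = j.
               (- 1) ^ j * of_nat ((t + length A - j - 1) choose t) *
               (\<Prod>i<length A. recip_bernoulli (js ! i) (A ! i) / fact (js ! i)))
            + (\<Sum>j<length ns. wave p m ns rs j t))
       \<and> (\<forall>j<length ns.
            (\<exists>\<alpha> :: nat \<Rightarrow> nat \<Rightarrow> rat.
               (\<forall>i<rs ! j. \<forall>t. \<alpha> i (t + ns ! j) = \<alpha> i t) \<and>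
               (\<forall>t. wave p m ns rs j t = (\<Sum>i<rs ! j. \<alpha> i t * of_nat t ^ i)))
          \<and> (\<lambda>t. of_rat (wave p m ns rs j t)
                   - wave_lead p m ns rs j t * of_nat t ^ (rs ! j - 1) / fact (rs ! j - 1))
              \<in> O(\<lambda>t. of_nat t powi (int (rs ! j) - 2)))"
proof -
  have A_nonempty: "A \<noteq> []"
  proof
    assume "A = []"
    with assms(2) show False by simp
  qed
  have ns_pos: "ns ! i > 0" if "i < length ns" for i
  proof -
    have "ns ! i \<ge> 2" using assms(4) nth_mem[OF that] by blast
    then show ?thesis by simp
  qed
  have rs_pos: "rs ! i > 0" if "i < length ns" for i
  proof -
    have "rs ! i \<in> set rs" using that assms(3) by simp
    then have "1 \<le> rs ! i" using assms(6) by blast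
    then show ?thesis by simp
  qed
  have factorization: "p * (\<Prod>i<length A. 1 - monom 1 (A ! i)) =
      (1 - monom 1 1) ^ m * (\<Prod>j<length ns. (1 - monom 1 (ns ! j)) ^ (rs ! j))"
    (is "p * ?D = ?E")
  proof -
    have "?D \<noteq> 0" using assms(1) one_minus_monom_nonzero by simp
    moreover have "?E \<noteq> 0" using ns_pos one_minus_monom_nonzero one_minus_monom_nonzero[of 1] by simp
    moreover have "1 / to_fract ?D = to_fract p / to_fract ?E"
      using assms(7) by (simp only: to_fract_prod to_fract_power to_fract_mult)
    ultimately have "1 * to_fract ?E = to_fract p * to_fract ?D"
      by (subst (asm) frac_eq_eq) (simp_all only: to_fract_eq_0_iff not_False_eq_True)
    then have "to_fract (p * ?D) = to_fract ?E"
      by (simp only: to_fract_mult mult_1)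
    then show ?thesis by (simp only: to_fract_eq_iff)
  qed
  interpret denumerant_factorization A ns rs m p
  proof unfold_locales
    show "a > 0" if "a \<in> set A" for a using assms(1) that by blast
    show "coprime (ns ! i) (ns ! j)" if "i < length ns" "j < length ns" "i \<noteq> j" for i j
      using assms(5) that by blast
  qed (fact A_nonempty assms(3) ns_pos rs_pos factorization)+
  have "of_nat (denumerant t A) =
      1 / (\<Prod>i<length A. of_nat (A ! i)) *
      (\<Sum>j<length A. \<Sum>js | length js = length A \<and> sum_list js = j.
         (- 1) ^ j * of_nat ((t + length A - j - 1) choose t) *
         (\<Prod>i<length A. recip_bernoulli (js ! i) (A ! i) / fact (js ! i)))
      + (\<Sum>j<length ns. wave p m ns rs j t)" for t
    unfolding denumerant_decomposition expansion_at_1_nth[OF A_nonempty]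
    by (simp add: sum_distrib_left sum_distrib_right mult_ac)
  moreover have "\<exists>\<alpha> :: nat \<Rightarrow> nat \<Rightarrow> rat.
               (\<forall>i<rs ! j. \<forall>t. \<alpha> i (t + ns ! j) = \<alpha> i t) \<and>
               (\<forall>t. wave p m ns rs j t = (\<Sum>i<rs ! j. \<alpha> i t * of_nat t ^ i))"
    and "(\<lambda>t. of_rat (wave p m ns rs j t)
                   - wave_lead p m ns rs j t * of_nat t ^ (rs ! j - 1) / fact (rs ! j - 1))
              \<in> O(\<lambda>t. of_nat t powi (int (rs ! j) - 2))" if j: "j < length ns" for j
  proof -
    obtain \<alpha> :: "nat \<Rightarrow> nat \<Rightarrow> rat" where
      per: "\<And>i t. \<alpha> i (t + ns ! j) = \<alpha> i t" and
      quasi: "\<And>t. wave p m ns rs j t = (\<Sum>i<rs ! j. \<alpha> i t * of_nat t ^ i)" and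
      lead: "\<And>t. of_rat (\<alpha> (rs ! j - 1) t) = wave_lead p m ns rs j t / fact (rs ! j - 1)"
      using wave_quasi_polynomial[OF j] by blast
    show "\<exists>\<alpha> :: nat \<Rightarrow> nat \<Rightarrow> rat.
               (\<forall>i<rs ! j. \<forall>t. \<alpha> i (t + ns ! j) = \<alpha> i t) \<and>
               (\<forall>t. wave p m ns rs j t = (\<Sum>i<rs ! j. \<alpha> i t * of_nat t ^ i))"
      using per quasi by blast
    obtain r where r: "rs ! j = Suc r" using rs_pos[OF j] gr0_implies_Suc by blast
    have "of_rat (wave p m ns rs j t) - wave_lead p m ns rs j t * of_nat t ^ (rs ! j - 1) / fact (rs ! j - 1)
        = (\<Sum>i<r. of_rat (\<alpha> i t) * of_nat t ^ i)" for t
      using lead[of t] by (simp add: quasi r of_rat_sum of_rat_add of_rat_mult of_rat_power)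
    then show "(\<lambda>t. of_rat (wave p m ns rs j t)
                   - wave_lead p m ns rs j t * of_nat t ^ (rs ! j - 1) / fact (rs ! j - 1))
              \<in> O(\<lambda>t. of_nat t powi (int (rs ! j) - 2))"
      using periodic_coefficients_bigo[OF ns_pos[OF j], of r \<alpha>] per by (simp only: r)
  qed
  ultimately show ?thesis by blast
qed

end
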